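(* Let $\mathcal H$ be a real Hilbert space and $F=f+\Psi$, where $f:\mathcal H\to\mathbb R$ is convex and twice continuously differentiable with globally $L$-Lipschitz continuous gradient for some $L>0$, and $\Psi:\mathcal H\to[-\infty,\infty]$ is convex, proper and closed. Let $\mathcal S=\{x: r(x)=0\}$ be nonempty, and let $F^*:=\min F$. Assume that for some $\epsilon>0$, $\kappa>0$, $q>0$ the error bound $$\operatorname{dist}(x,\mathcal S)\le\kappa\,r(x)^q\qquad\forall x\in V:=\{x: r(x)\le\epsilon\}$$ holds, and that $\nabla^2 f$ is $p$-Hölder continuous on $V$ for some $p\in(0,1]$ (i.e. $\|\nabla^2f(x)-\nabla^2f(y)\|\le\zeta\|x-y\|^p$ for all $x,y\in V$, for some $\zeta\ge0$). Consider the algorithm described in the context, with parameters $\beta,\gamma\in(0,1)$, $\nu\in[0,1)$, $\rho\in(0,1]$, $c>0$, $\delta>0$, and assume that $$(1+\rho)q>1,\qquad (1+p)q>1,\qquad (q+pq-\rho)(1+p)>1 .$$ If $\delta>0$ is such that $\|\tilde p_t\|^{2+\delta}=o\big(d_t^{(q+1)/q}\big)$ for all $t$ sufficiently large, then there is $t_0\ge 0$ such that $\alpha_t=1$ is accepted for all $t\ge t_0$, and, with $$s:=\min\{(1+\rho)q,\ (1+p)q,\ (q+pq-\rho)(1+p)\}-1>0,$$ we have for all $t\ge t_0$ $$d_{t+1}=O\left(d_t^{1+s}\right),\qquad r_{t+1}=O\left(r_t^{1+s}\right),\qquad F(x_{t+1})-F^*=O\left(\big(F(x_t)-F^*\big)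^{1+s}\right).$$
   Context: Notation: $\operatorname{prox}_g(x)$ is the minimizer over $y\in\mathcal H$ of $\tfrac12\|y-x\|^2+g(y)$; $R(x):=x-\operatorname{prox}_\Psi(x-\nabla f(x))$, $r(x):=\|R(x)\|$; $\mathcal S=\{x:r(x)=0\}$ (for convex $f$, the set of minimizers of $F$). Along the iterates, $r_t:=r(x_t)$, $d_t:=\operatorname{dist}(x_t,\mathcal S)$. Algorithm. Input $x_0\in\mathcal H$ and the parameters above. For $t=0,1,\dots$: (1) Let $g_t:=\nabla f(x_t)$, $\mu_t:=c\,r(x_t)^\rho$, $H_t:=J_t+\mu_t\mathrm{Id}$, where $J_t$ is a symmetric, positive semidefinite bounded linear operator with $\|J_t-\nabla^2f(x_t)\|=O(r(x_t)^\theta)$ for some $\theta\ge\rho$ (constant independent of $t$). Let $$q_t(x):=\langle g_t,x-x_t\rangle+\tfrac12\langle H_t(x-x_t),x-x_t\rangle+\Psi(x),\quad \hat r_t(x):=\left\|x-\operatorname{prox}_\Psi\big(x-g_t-H_t(x-x_t)\big)\right\| .$$ Find an approximate minimizer $\tilde x_{t+1}$ of $q_t$, namely any point with $q_t(\tilde x_{t+1})\le q_t(x_t)$ and $\hat r_t(\tilde x_{t+1})\le\nu\min\{r(x_t)^{1+\rho},r(x_t)\}$. (2) Set $\tilde p_t:=\tilde x_{t+1}-x_t$; terminate if $\tilde p_t=0$. (The algorithm is also understood to stop if $r(x_t)=0$, so $r(x_t)>0$ whenever a step is taken.) (3) For $\alpha>0$ let $y_{t+1}(\alpha):=x_t+\alpha\tilde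 p_t$ and $\bar x_{t+1}(\alpha):=\operatorname{prox}_{\Psi/L}\big(y_{t+1}(\alpha)-\tfrac1L\nabla f(y_{t+1}(\alpha))\big)$. Starting with $\alpha_t=1$, replace $\alpha_t$ by $\beta\alpha_t$ until $$F(\bar x_{t+1}(\alpha_t))\le F(x_t)-\gamma\alpha_t^2\|\tilde p_t\|^{2+\delta};$$ then set $x_{t+1}:=\bar x_{t+1}(\alpha_t)$. The algorithm is assumed to generate an infinite sequence. $O$ and $o$ are for $t\to\infty$: $\sigma_t=O(\tau_t)$ if $\sigma_t\le\beta'\tau_t$ for some $\beta'>0$ and all large $t$; $\sigma_t=o(\tau_t)$ if for every $\beta'>0$, $\sigma_t\le\beta'\tau_t$ for all large $t$. *)

theory Defs
  imports "HOL-Analysis.Analysis" "HOL-Library.Landau_Symbols"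
begin

definition ereal_epigraph :: "('a \<Rightarrow> ereal) \<Rightarrow> ('a \<times> real) set" where
  "ereal_epigraph g = {(x, a). g x \<le> ereal a}"

definition proper_fun :: "('a \<Rightarrow> ereal) \<Rightarrow> bool" where
  "proper_fun g \<longleftrightarrow> (\<forall>x. g x \<noteq> -\<infinity>) \<and> (\<exists>x. g x \<noteq> \<infinity>)"

definition convex_fun :: "('a::real_vector \<Rightarrow> ereal) \<Rightarrow> bool" where
  "convex_fun g \<longleftrightarrow> convex (ereal_epigraph g)"

definition closed_fun :: "('a::topological_space \<Rightarrow> ereal) \<Rightarrow> bool" where
  "closed_fun g \<longleftrightarrow> closed (ereal_epigraph g)"

text \<open>The minimizer exists and is unique for proper, convex and closed \<open>g\<close> on a Hilbert space;
  otherwise \<open>prox g x\<close> may be an arbitrary point.\<close>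
definition prox :: "('a::real_inner \<Rightarrow> ereal) \<Rightarrow> 'a \<Rightarrow> 'a" where
  "prox g x = arg_min (\<lambda>y. ereal (1/2 * (norm (y - x))\<^sup>2) + g y) (\<lambda>_. True)"

definition objective :: "('a \<Rightarrow> real) \<Rightarrow> ('a \<Rightarrow> ereal) \<Rightarrow> 'a \<Rightarrow> ereal" where
  "objective f \<Psi> x = ereal (f x) + \<Psi> x"

definition residual :: "('a::real_inner \<Rightarrow> 'a) \<Rightarrow> ('a \<Rightarrow> ereal) \<Rightarrow> 'a \<Rightarrow> real" where
  "residual gradf \<Psi> x = norm (x - prox \<Psi> (x - gradf x))"

definition solutions :: "('a::real_inner \<Rightarrow> 'a) \<Rightarrow> ('a \<Rightarrow> ereal) \<Rightarrow> 'a set" where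
  "solutions gradf \<Psi> = {x. residual gradf \<Psi> x = 0}"

definition model ::
  "'a::real_inner \<Rightarrow> ('a \<Rightarrow>\<^sub>L 'a) \<Rightarrow> ('a \<Rightarrow> ereal) \<Rightarrow> 'a \<Rightarrow> 'a \<Rightarrow> ereal" where
  "model g H \<Psi> xt x =
     ereal (g \<bullet> (x - xt) + 1/2 * (blinfun_apply H (x - xt) \<bullet> (x - xt))) + \<Psi> x"

definition model_residual ::
  "'a::real_inner \<Rightarrow> ('a \<Rightarrow>\<^sub>L 'a) \<Rightarrow> ('a \<Rightarrow> ereal) \<Rightarrow> 'a \<Rightarrow> 'a \<Rightarrow> real" where
  "model_residual g H \<Psi> xt x = norm (x - prox \<Psi> (x - g - blinfun_apply H (x - xt)))"

definition prox_grad_step ::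
  "('a::real_inner \<Rightarrow> 'a) \<Rightarrow> ('a \<Rightarrow> ereal) \<Rightarrow> real \<Rightarrow> 'a \<Rightarrow> 'a" where
  "prox_grad_step gradf \<Psi> L y = prox (\<lambda>z. \<Psi> z / ereal L) (y - (1/L) *\<^sub>R gradf y)"

definition trial_point ::
  "('a::real_inner \<Rightarrow> 'a) \<Rightarrow> ('a \<Rightarrow> ereal) \<Rightarrow> real \<Rightarrow> 'a \<Rightarrow> 'a \<Rightarrow> real \<Rightarrow> 'a" where
  "trial_point gradf \<Psi> L xt p a = prox_grad_step gradf \<Psi> L (xt + a *\<^sub>R p)"

definition step_accepted ::
  "('a::real_inner \<Rightarrow> real) \<Rightarrow> ('a \<Rightarrow> 'a) \<Rightarrow> ('a \<Rightarrow> ereal) \<Rightarrow> real \<Rightarrow> real \<Rightarrow> real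
     \<Rightarrow> 'a \<Rightarrow> 'a \<Rightarrow> real \<Rightarrow> bool" where
  "step_accepted f gradf \<Psi> L \<gamma> \<delta> xt p a \<longleftrightarrow>
     objective f \<Psi> (trial_point gradf \<Psi> L xt p a)
       \<le> objective f \<Psi> xt - ereal (\<gamma> * a\<^sup>2 * norm p powr (2 + \<delta>))"

definition sym_psd :: "('a::real_inner \<Rightarrow>\<^sub>L 'a) \<Rightarrow> bool" where
  "sym_psd J \<longleftrightarrow>
     (\<forall>u v. blinfun_apply J u \<bullet> v = u \<bullet> blinfun_apply J v) \<and> (\<forall>u. 0 \<le> blinfun_apply J u \<bullet> u)"

text \<open>\<open>x\<close>, \<open>xn\<close>, \<open>J\<close>, \<open>\<alpha>\<close> are an infinite run of the method: the iterates \<open>x\<^sub>t\<close>, the approximate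
  model minimizers (\<open>xn t\<close> is computed from \<open>x t\<close>, i.e. it is the point with index \<open>t + 1\<close>), the
  Hessian approximations and the accepted step sizes.  Infinite means that neither stopping test
  ever fires and that every backtracking loop ends.\<close>
definition newton_run ::
  "('a::real_inner \<Rightarrow> real) \<Rightarrow> ('a \<Rightarrow> 'a) \<Rightarrow> ('a \<Rightarrow> 'a \<Rightarrow>\<^sub>L 'a) \<Rightarrow> ('a \<Rightarrow> ereal) \<Rightarrow> real \<Rightarrow>
   real \<Rightarrow> real \<Rightarrow> real \<Rightarrow> real \<Rightarrow> real \<Rightarrow> real \<Rightarrow>
   (nat \<Rightarrow> 'a) \<Rightarrow> (nat \<Rightarrow> 'a) \<Rightarrow> (nat \<Rightarrow> 'a \<Rightarrow>\<^sub>L 'a) \<Rightarrow> (nat \<Rightarrow> real) \<Rightarrow> bool" where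
  "newton_run f gradf hessf \<Psi> L \<beta> \<gamma> \<nu> \<rho> c \<delta> x xn J \<alpha> \<longleftrightarrow>
     (\<forall>t. sym_psd (J t)) \<and>
     (\<exists>\<theta>\<ge>\<rho>. (\<lambda>t. norm (J t - hessf (x t))) \<in> O(\<lambda>t. residual gradf \<Psi> (x t) powr \<theta>)) \<and>
     (\<forall>t. let r = residual gradf \<Psi> (x t);
              g = gradf (x t);
              \<mu> = c * r powr \<rho>;
              H = J t + \<mu> *\<^sub>R id_blinfun;
              p = xn t - x t
          in r > 0 \<and>
             model g H \<Psi> (x t) (xn t) \<le> model g H \<Psi> (x t) (x t) \<and>
             model_residual g H \<Psi> (x t) (xn t) \<le> \<nu> * min (r powr (1 + \<rho>)) r \<and>
             p \<noteq> 0 \<and>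
             (\<exists>k. \<alpha> t = \<beta> ^ k \<and> step_accepted f gradf \<Psi> L \<gamma> \<delta> (x t) p (\<beta> ^ k) \<and>
                  (\<forall>j<k. \<not> step_accepted f gradf \<Psi> L \<gamma> \<delta> (x t) p (\<beta> ^ j))) \<and>
             x (Suc t) = trial_point gradf \<Psi> L (x t) p (\<alpha> t))"

end

theory Submission
  imports Defs
begin

text \<open>
  The line search accepts every step size \<open>a \<le> 1\<close> with \<open>a (L/2 + \<gamma> \<parallel>p\<parallel>\<^sup>\<delta>) \<le> \<mu>/2\<close>, and
  \<open>\<parallel>p\<parallel>\<close> is bounded below and above in terms of \<open>r\<close>, so \<open>F\<close> could not stay bounded below if
  \<open>r(x\<^sub>t)\<close> did not tend to \<open>0\<close>. The run therefore enters the region of the error bound.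

  There, monotonicity of the subdifferential of \<open>\<Psi>\<close>, applied to the inexact model minimizer and a
  nearly closest solution, gives \<open>\<mu>\<^sub>t \<parallel>p\<^sub>t\<parallel> = O(r\<^sub>t\<^sup>\<rho> d\<^sub>t + d\<^sub>t\<^sup>1\<^sup>+\<^sup>p)\<close>. A Taylor estimate then bounds
  the residual at the model minimizer by \<open>O(d\<^sub>t\<^sup>e)\<close> with \<open>e = (1 + s)/q\<close>; the proximal gradient
  step with constant \<open>L\<close> preserves this order, and the error bound turns it into
  \<open>O(d\<^sub>t\<^sup>1\<^sup>+\<^sup>s)\<close> for the distance.

  The error bound also implies the growth condition \<open>F - F\<^sup>* \<ge> c\<^sub>0 d\<^sup>1\<^sup>+\<^sup>1\<^sup>/\<^sup>q\<close>. Since the gap at the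
  proximal gradient point is of smaller order, the unit step passes the decrease test, and the rate
  for \<open>F\<close> follows from the one for \<open>d\<close>.
\<close>

subsection \<open>Subgradients and proximal points\<close>

text \<open>Finiteness at \<open>z\<close> is built in, so every subgradient comes with a real value
  at its base point and extended-real inequalities reduce to real ones.\<close>

definition is_subgradient :: "('a::real_inner \<Rightarrow> ereal) \<Rightarrow> 'a \<Rightarrow> 'a \<Rightarrow> bool" where
  "is_subgradient g z v \<longleftrightarrow> \<bar>g z\<bar> \<noteq> \<infinity> \<and> (\<forall>y. g z + ereal (v \<bullet> (y - z)) \<le> g y)"

lemma is_subgradient_finite:
  assumes "is_subgradient g z v"
  obtains a where "g z = ereal a"
  using assms unfolding is_subgradient_def by (cases "g z") auto

lemma is_subgradientD:
  assumes "is_subgradient g z v" "g z = ereal a" "g y = ereal b"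
  shows "a + v \<bullet> (y - z) \<le> b"
  using assms unfolding is_subgradient_def by (metis ereal_less_eq(3) plus_ereal.simps(1))

lemma is_subgradientI:
  assumes "proper_fun g" "g z = ereal a"
    and "\<And>y b. g y = ereal b \<Longrightarrow> a + v \<bullet> (y - z) \<le> b"
  shows "is_subgradient g z v"
proof -
  have "g z + ereal (v \<bullet> (y - z)) \<le> g y" for y
  proof (cases "g y")
    case (real b)
    then show ?thesis using assms(2) assms(3)[OF real] by simp
  next
    case MInf
    then show ?thesis using assms(1) by (auto simp: proper_fun_def)
  qed simp
  then show ?thesis using assms(2) by (auto simp: is_subgradient_def)
qed

lemma is_subgradient_monotone:
  assumes "is_subgradient g z v" "is_subgradient g z' v'"
  shows "0 \<le> (v - v') \<bullet> (z - z')"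
proof -
  obtain a where a: "g z = ereal a" using assms(1) by (rule is_subgradient_finite)
  obtain b where b: "g z' = ereal b" using assms(2) by (rule is_subgradient_finite)
  show ?thesis
    using is_subgradientD[OF assms(1) a b] is_subgradientD[OF assms(2) b a]
    by (simp add: inner_diff_left inner_diff_right)
qed

lemma convex_funD:
  assumes "convex_fun g" "g y \<le> ereal a" "g z \<le> ereal b" "0 \<le> t" "t \<le> 1"
  shows "g (y + t *\<^sub>R (z - y)) \<le> ereal (a + t * (b - a))"
proof -
  have "(1 - t) *\<^sub>R (y, a) + t *\<^sub>R (z, b) \<in> ereal_epigraph g"
    using assms unfolding convex_fun_def
    by (intro convexD) (auto simp: ereal_epigraph_def)
  moreover have "(1 - t) *\<^sub>R (y, a) + t *\<^sub>R (z, b) = (y + t *\<^sub>R (z - y), a + t * (b - a))"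
    by (simp add: algebra_simps)
  ultimately show ?thesis by (simp add: ereal_epigraph_def)
qed

lemma closed_funD:
  fixes g :: "'a::first_countable_topology \<Rightarrow> ereal"
  assumes "closed_fun g" "X \<longlonglongrightarrow> l" "A \<longlonglongrightarrow> a" "\<And>n. g (X n) \<le> ereal (A n)"
  shows "g l \<le> ereal a"
proof -
  have "(l, a) \<in> ereal_epigraph g"
    using assms(1) unfolding closed_fun_def
    by (rule closed_sequentially[where f = "\<lambda>n. (X n, A n)"])
       (use assms in \<open>auto simp: ereal_epigraph_def intro!: tendsto_Pair\<close>)
  then show ?thesis by (simp add: ereal_epigraph_def)
qed

text \<open>Lower semicontinuity gives a lower bound on a ball around one point of the domain, and
  convexity propagates it along rays.\<close>
lemma convex_closed_fun_lower_bound: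
  fixes g :: "'a::real_inner \<Rightarrow> ereal"
  assumes "convex_fun g" "proper_fun g" "closed_fun g"
  obtains z a K where "g z = ereal a" "\<And>y b. g y \<le> ereal b \<Longrightarrow> a - 1 - K * norm (y - z) \<le> b"
proof -
  obtain z a where a: "g z = ereal a"
    using assms(2) unfolding proper_fun_def by (metis ereal_cases)
  have "open (- ereal_epigraph g)" using assms(3) by (simp add: closed_fun_def open_Compl)
  moreover have "(z, a - 1) \<in> - ereal_epigraph g" using a by (simp add: ereal_epigraph_def)
  ultimately obtain e where e: "e > 0" "ball (z, a - 1) e \<subseteq> - ereal_epigraph g"
    using open_contains_ball by blast
  define \<eta> where "\<eta> = e / 2"
  have \<eta>: "0 < \<eta>" "\<eta> < e" using e(1) by (auto simp: \<eta>_def)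
  have low: "\<not> g y \<le> ereal (a - 1)" if "norm (y - z) \<le> \<eta>" for y
  proof -
    have "(y, a - 1) \<in> ball (z, a - 1) e"
      using that \<eta> by (simp add: dist_Pair_Pair dist_norm norm_minus_commute)
    then show ?thesis using e(2) by (auto simp: ereal_epigraph_def)
  qed
  have "a - 1 - (1 / \<eta>) * norm (y - z) \<le> b" if "g y \<le> ereal b" for y b
  proof (cases "norm (y - z) \<le> \<eta>")
    case True
    then have "a - 1 < b" using low[OF True] that
      by (meson ereal_less_eq(3) not_le order_trans)
    moreover have "0 \<le> (1 / \<eta>) * norm (y - z)" using \<eta> by simp
    ultimately show ?thesis by linarith
  next
    case False
    define t where "t = \<eta> / norm (y - z)"
    have "0 < norm (y - z)" using False \<eta> by linarith
    then have t: "0 < t" "t \<le> 1" "norm (t *\<^sub>R (y - z)) = \<eta>"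
      using False \<eta> by (auto simp: t_def divide_le_eq_1)
    have "g (z + t *\<^sub>R (y - z)) \<le> ereal (a + t * (b - a))"
      using convex_funD[OF assms(1) _ that] a t by simp
    moreover have "\<not> g (z + t *\<^sub>R (y - z)) \<le> ereal (a - 1)"
      using t by (intro low) simp
    ultimately have "a - 1 < a + t * (b - a)"
      by (meson ereal_less_eq(3) not_le order_trans)
    then have "- (1 / t) < b - a" using t by (simp add: field_simps)
    moreover have "1 / t = (1 / \<eta>) * norm (y - z)" using t by (simp add: t_def)
    ultimately show ?thesis by linarith
  qed
  then show ?thesis using a that by blast
qed

section \<open>Existence, uniqueness and nonexpansiveness of proximal points\<close>

lemma parallelogram_midpoint:
  fixes y z x :: "'a::real_inner"
  shows "4 * (norm (y + (1/2) *\<^sub>R (z - y) - x))\<^sup>2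
    = 2 * (norm (y - x))\<^sup>2 + 2 * (norm (z - x))\<^sup>2 - (norm (y - z))\<^sup>2"
  by (simp add: power2_norm_eq_inner inner_diff_left inner_diff_right inner_add_left
      inner_add_right inner_commute field_simps)

text \<open>Let \<open>t\<close> tend to 0 from the right. First-order conditions are extracted in
  this way: an inequality along a segment is divided by \<open>t\<close>, and a quadratic remainder
  leaves the term \<open>t * M\<close>.\<close>

lemma nonpos_if_le_small_multiples:
  fixes e M :: real
  assumes "\<And>t. 0 < t \<Longrightarrow> t \<le> 1 \<Longrightarrow> e \<le> t * M"
  shows "e \<le> 0"
proof -
  have "((\<lambda>t. t * M) \<longlongrightarrow> 0 * M) (at_right (0::real))"
    by (intro tendsto_intros)
  moreover have "eventually (\<lambda>t. e \<le> t * M) (at_right (0::real))"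
    unfolding eventually_at_right_field by (rule exI[of _ 1]) (use assms in auto)
  ultimately have "e \<le> 0 * M" by (rule tendsto_lowerbound) simp
  then show ?thesis by simp
qed

text \<open>Strong convexity of the squared norm replaces compactness: by the parallelogram law a
  minimizing sequence is Cauchy, closedness of the epigraph handles the limit, and comparing the
  limit with points on segments yields the subgradient.\<close>

lemma prox_point_exists:
  fixes g :: "'a::{real_inner, complete_space} \<Rightarrow> ereal" and x :: 'a
  assumes "convex_fun g" "proper_fun g" "closed_fun g"
  obtains z where "is_subgradient g z (x - z)"
proof -
  obtain z0 a0 K where z0: "g z0 = ereal a0"
    and low: "\<And>y b. g y \<le> ereal b \<Longrightarrow> a0 - 1 - K * norm (y - z0) \<le> b"
    using convex_closed_fun_lower_bound[OF assms] by blast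
  \<comment> \<open>\<open>A\<close> ranges over points of the epigraph instead of values of
    \<open>g\<close>, so it is a set of reals with a real infimum.\<close>
  define A where "A = {(norm (y - x))\<^sup>2 / 2 + b | y b. g y \<le> ereal b}"
  define m where "m = Inf A"
  have ne: "A \<noteq> {}" using z0 unfolding A_def by (metis (mono_tags, lifting) empty_iff mem_Collect_eq order_refl)
  \<comment> \<open>Young's inequality: the quadratic term absorbs the linear decay that the lower
    bound on \<open>g\<close> permits.\<close>
  have "a0 - 1 - \<bar>K\<bar> * norm (x - z0) - K\<^sup>2 / 2 \<le> v" if v: "v \<in> A" for v
  proof -
    obtain y b where yb: "g y \<le> ereal b" "v = (norm (y - x))\<^sup>2 / 2 + b"
      using v unfolding A_def by blast
    have "norm (y - z0) \<le> norm (y - x) + norm (x - z0)"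
      by (metis diff_add_cancel norm_triangle_ineq add_diff_eq)
    then have "\<bar>K\<bar> * norm (y - z0) \<le> \<bar>K\<bar> * norm (y - x) + \<bar>K\<bar> * norm (x - z0)"
      by (metis abs_ge_zero distrib_left mult_left_mono)
    moreover have "K * norm (y - z0) \<le> \<bar>K\<bar> * norm (y - z0)"
      by (simp add: mult_right_mono)
    moreover have "0 \<le> (norm (y - x) - \<bar>K\<bar>)\<^sup>2 / 2" by simp
    then have "\<bar>K\<bar> * norm (y - x) \<le> (norm (y - x))\<^sup>2 / 2 + K\<^sup>2 / 2"
      by (simp add: power2_diff algebra_simps)
    ultimately show ?thesis using low[OF yb(1)] yb(2) by linarith
  qed
  then have bdd: "bdd_below A" by (meson bdd_belowI)
  have m_le: "m \<le> (norm (y - x))\<^sup>2 / 2 + b" if "g y \<le> ereal b" for y b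
    unfolding m_def using that bdd by (intro cInf_lower) (auto simp: A_def)
  have "\<exists>y b. g y \<le> ereal b \<and> (norm (y - x))\<^sup>2 / 2 + b < m + 1 / real (Suc n)" for n
  proof -
    have "\<exists>v\<in>A. v < m + 1 / real (Suc n)"
      using cInf_lessD[OF ne, of "m + 1 / real (Suc n)"] unfolding m_def by fastforce
    then show ?thesis by (auto simp: A_def)
  qed
  then obtain Y B where Y: "\<And>n. g (Y n) \<le> ereal (B n)"
    and YB: "\<And>n. (norm (Y n - x))\<^sup>2 / 2 + B n < m + 1 / real (Suc n)"
    by metis
  define \<tau> where "\<tau> n = 1 / real (Suc n)" for n
  have close: "(norm (Y n - Y k))\<^sup>2 \<le> 4 * \<tau> n + 4 * \<tau> k" for n k
  proof -
    have "g (Y n + (1/2) *\<^sub>R (Y k - Y n)) \<le> ereal (B n / 2 + B k / 2)"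
      using convex_funD[OF assms(1) Y[of n] Y[of k], of "1/2"] by (simp add: field_simps)
    from m_le[OF this] have "(norm (Y n - Y k))\<^sup>2
        \<le> 2 * (norm (Y n - x))\<^sup>2 + 2 * (norm (Y k - x))\<^sup>2 + 4 * B n + 4 * B k - 8 * m"
      using parallelogram_midpoint[of "Y n" "Y k" x] by linarith
    moreover have "(norm (Y i - x))\<^sup>2 + 2 * B i \<le> 2 * m + 2 * \<tau> i" for i
      using YB[of i] unfolding \<tau>_def[symmetric] by linarith
    from this[of n] this[of k]
    have "(norm (Y n - x))\<^sup>2 + (norm (Y k - x))\<^sup>2 + 2 * B n + 2 * B k \<le> 4 * m + 2 * \<tau> n + 2 * \<tau> k"
      by linarith
    ultimately show ?thesis by linarith
  qed
  have "Cauchy Y"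
  proof (rule metric_CauchyI)
    fix e :: real assume "e > 0"
    then obtain M where M: "1 / real (Suc M) < e\<^sup>2 / 8"
      using nat_approx_posE[of "e\<^sup>2 / 8"] by (metis divide_pos_pos zero_less_numeral zero_less_power)
    show "\<exists>M. \<forall>n\<ge>M. \<forall>k\<ge>M. dist (Y n) (Y k) < e"
    proof (intro exI[of _ M] allI impI)
      fix n k assume nk: "n \<ge> M" "k \<ge> M"
      then have "1 / real (Suc n) \<le> 1 / real (Suc M)" "1 / real (Suc k) \<le> 1 / real (Suc M)"
        by (auto intro!: divide_left_mono)
      then have "(norm (Y n - Y k))\<^sup>2 < e\<^sup>2" using close[of n k] M by (simp only: \<tau>_def[symmetric])
      then show "dist (Y n) (Y k) < e"
        using \<open>e > 0\<close> by (simp add: dist_norm power2_less_imp_less)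
    qed
  qed
  then obtain z where z: "Y \<longlonglongrightarrow> z" using Cauchy_convergent convergent_def by blast
  \<comment> \<open>The value that \<open>g\<close> takes at \<open>z\<close> if the infimum is
    attained there: closedness gives \<open>g z \<le> ereal c\<close>, and minimality of
    \<open>m\<close> the reverse.\<close>
  define c where "c = m - (norm (z - x))\<^sup>2 / 2"
  have lim: "(\<lambda>n. 1 / real (Suc n)) \<longlonglongrightarrow> 0" by (rule LIMSEQ_Suc[OF lim_1_over_n])
  have sq: "(\<lambda>n. (norm (Y n - x))\<^sup>2) \<longlonglongrightarrow> (norm (z - x))\<^sup>2"
    by (intro tendsto_intros z)
  have "(\<lambda>n. m + 1 / real (Suc n) - (norm (Y n - x))\<^sup>2 / 2) \<longlonglongrightarrow> m + 0 - (norm (z - x))\<^sup>2 / 2"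
    by (intro tendsto_diff tendsto_add tendsto_const lim tendsto_divide[OF sq]) simp
  then have lim': "(\<lambda>n. m + 1 / real (Suc n) - (norm (Y n - x))\<^sup>2 / 2) \<longlonglongrightarrow> c"
    by (simp only: c_def add_0_right)
  have "g (Y n) \<le> ereal (m + 1 / real (Suc n) - (norm (Y n - x))\<^sup>2 / 2)" for n
  proof -
    have "B n \<le> m + 1 / real (Suc n) - (norm (Y n - x))\<^sup>2 / 2"
      using YB[of n] unfolding \<tau>_def[symmetric] by linarith
    then show ?thesis using Y[of n] by (meson ereal_less_eq(3) order_trans)
  qed
  then have gz: "g z \<le> ereal c" by (rule closed_funD[OF assms(3) z lim'])
  obtain a where a: "g z = ereal a"
    using gz assms(2) by (cases "g z") (auto simp: proper_fun_def)
  have "m \<le> (norm (z - x))\<^sup>2 / 2 + a" using m_le[of z a] a by simp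
  then have ac: "a = c" using gz a unfolding c_def by simp
  have "a + (x - z) \<bullet> (y - z) \<le> b" if "g y = ereal b" for y b
  proof -
    \<comment> \<open>The violation of the subgradient inequality at \<open>y\<close>. Moving from
      \<open>z\<close> towards \<open>y\<close> by a fraction \<open>t\<close> shows that it is at
      most of order \<open>t\<close>.\<close>
    define e where "e = a + (x - z) \<bullet> (y - z) - b"
    have le: "e \<le> t * ((norm (y - z))\<^sup>2 / 2)" if t: "0 < t" "t \<le> 1" for t
    proof -
      have "g (z + t *\<^sub>R (y - z)) \<le> ereal (a + t * (b - a))"
        using convex_funD[OF assms(1), of z a y b t] a \<open>g y = ereal b\<close> t by simp
      from m_le[OF this] have "c + (norm (z - x))\<^sup>2 / 2
          \<le> (norm (z + t *\<^sub>R (y - z) - x))\<^sup>2 / 2 + (a + t * (b - a))"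
        by (simp add: c_def)
      moreover have "(norm (z + t *\<^sub>R (y - z) - x))\<^sup>2
          = (norm (z - x))\<^sup>2 + t\<^sup>2 * (norm (y - z))\<^sup>2 - 2 * t * ((x - z) \<bullet> (y - z))"
        by (simp add: power2_norm_eq_inner inner_diff_left inner_diff_right inner_add_left
            inner_add_right inner_commute power2_eq_square[of t] algebra_simps)
      ultimately have "t * e \<le> t * (t * ((norm (y - z))\<^sup>2 / 2))"
        using ac by (simp add: e_def algebra_simps power2_eq_square)
      then show ?thesis using t by simp
    qed
    have "e \<le> 0" using le by (rule nonpos_if_le_small_multiples)
    then show ?thesis by (simp add: e_def)
  qed
  then show ?thesis
    using that is_subgradientI[OF assms(2) a] by blast
qed

text \<open>Expanding the square turns the subgradient inequality into an excess of at least half of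
  \<open>(norm (y - z))\<^sup>2\<close> over the value at \<open>z\<close>. Strictness matters
  because \<open>prox\<close> chooses among the minimizers.\<close>

lemma prox_eqI:
  assumes "proper_fun g" "is_subgradient g z (x - z)"
  shows "prox g x = z"
proof -
  let ?h = "\<lambda>y. ereal (1/2 * (norm (y - x))\<^sup>2) + g y"
  obtain a where a: "g z = ereal a" using assms(2) by (rule is_subgradient_finite)
  have less: "?h z < ?h y" if "y \<noteq> z" for y
  proof (cases "g y")
    case (real b)
    have "1/2 * (norm (y - x))\<^sup>2 + (x - z) \<bullet> (y - z) = 1/2 * (norm (z - x))\<^sup>2 + 1/2 * (norm (y - z))\<^sup>2"
      by (simp add: power2_norm_eq_inner inner_diff_left inner_diff_right inner_commute field_simps)
    moreover have "0 < (norm (y - z))\<^sup>2" using that by simp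
    ultimately have "1/2 * (norm (z - x))\<^sup>2 + a < 1/2 * (norm (y - x))\<^sup>2 + b"
      using is_subgradientD[OF assms(2) a real] by linarith
    then show ?thesis using a real by simp
  qed (use assms(1) a in \<open>auto simp: proper_fun_def\<close>)
  have "is_arg_min ?h (\<lambda>_. True) z" unfolding is_arg_min_def using less by (metis less_asym less_irrefl)
  moreover have "y = z" if "is_arg_min ?h (\<lambda>_. True) y" for y
    using that less unfolding is_arg_min_def by blast
  ultimately show ?thesis unfolding prox_def arg_min_def by (rule some_equality)
qed

lemma is_subgradient_prox:
  fixes g :: "'a::{real_inner, complete_space} \<Rightarrow> ereal"
  assumes "convex_fun g" "proper_fun g" "closed_fun g"
  shows "is_subgradient g (prox g x) (x - prox g x)"
  using prox_point_exists[OF assms, of x] prox_eqI[OF assms(2)] by metis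

lemma prox_nonexpansive:
  fixes g :: "'a::{real_inner, complete_space} \<Rightarrow> ereal"
  assumes "convex_fun g" "proper_fun g" "closed_fun g"
  shows "norm (prox g x - prox g y) \<le> norm (x - y)"
proof -
  let ?u = "prox g x - prox g y"
  have "0 \<le> ((x - prox g x) - (y - prox g y)) \<bullet> ?u"
    using is_subgradient_monotone is_subgradient_prox[OF assms] by blast
  then have "?u \<bullet> ?u \<le> (x - y) \<bullet> ?u"
    by (simp add: inner_diff_left inner_diff_right)
  also have "\<dots> \<le> norm (x - y) * norm ?u" by (rule norm_cauchy_schwarz)
  finally have "norm ?u * norm ?u \<le> norm (x - y) * norm ?u"
    by (simp add: dot_square_norm power2_eq_square)
  then show ?thesis by (cases "norm ?u = 0") auto
qed

section \<open>Scaling of extended-real functions\<close>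

lemma ereal_epigraph_scale:
  assumes "c > 0"
  shows "g z / ereal c \<le> ereal a \<longleftrightarrow> g z \<le> ereal (c * a)"
  using assms by (cases "g z") (auto simp: field_simps)

text \<open>The epigraph of the scaled function is the preimage of the original one under a
  continuous linear map. Scaling is used with \<open>L\<close> for the proximal gradient step and
  with a distance-dependent factor for the growth condition.\<close>

lemma
  fixes g :: "'a::real_inner \<Rightarrow> ereal"
  assumes "c > 0"
  shows convex_fun_scale: "convex_fun g \<Longrightarrow> convex_fun (\<lambda>z. g z / ereal c)"
    and proper_fun_scale: "proper_fun g \<Longrightarrow> proper_fun (\<lambda>z. g z / ereal c)"
    and closed_fun_scale: "closed_fun g \<Longrightarrow> closed_fun (\<lambda>z. g z / ereal c)"
proof -
  have epi: "ereal_epigraph (\<lambda>z. g z / ereal c) = (\<lambda>w. (fst w, c * snd w)) -` ereal_epigraph g"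
    using ereal_epigraph_scale[OF assms, of g] by (auto simp: ereal_epigraph_def)
  have lin: "linear (\<lambda>w::'a \<times> real. (fst w, c * snd w))"
    by (rule linearI) (auto simp: algebra_simps)
  show "convex_fun (\<lambda>z. g z / ereal c)" if "convex_fun g"
    using convex_linear_vimage[OF lin] that by (simp add: convex_fun_def epi)
  show "closed_fun (\<lambda>z. g z / ereal c)" if "closed_fun g"
    unfolding closed_fun_def epi using that
    by (intro continuous_closed_vimage) (auto simp: closed_fun_def intro!: continuous_intros)
  show "proper_fun (\<lambda>z. g z / ereal c)" if pr: "proper_fun g"
  proof -
    obtain y b where "g y = ereal b" using pr unfolding proper_fun_def by (metis ereal_cases)
    then have "g y / ereal c \<noteq> \<infinity>" using assms by simp
    moreover have "g z / ereal c \<noteq> -\<infinity>" for z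
      using pr assms by (cases "g z") (auto simp: proper_fun_def)
    ultimately show ?thesis unfolding proper_fun_def by blast
  qed
qed

lemma is_subgradient_scale:
  assumes "c > 0" "proper_fun g" "is_subgradient (\<lambda>z. g z / ereal c) z v"
  shows "is_subgradient g z (c *\<^sub>R v)"
proof -
  obtain a where a: "g z / ereal c = ereal a" using assms(3) by (rule is_subgradient_finite)
  then have gz: "g z = ereal (c * a)" using assms(1) by (cases "g z") (auto simp: field_simps)
  show ?thesis
  proof (rule is_subgradientI[OF assms(2) gz])
    fix y b assume b: "g y = ereal b"
    then have "g y / ereal c = ereal (b / c)" using assms(1) by simp
    from is_subgradientD[OF assms(3) a this] show "c * a + (c *\<^sub>R v) \<bullet> (y - z) \<le> b"
      using assms(1) by (simp add: field_simps)
  qed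
qed

section \<open>Distance estimates without nearest points\<close>

lemma le_mult_infdistI:
  fixes A :: "'a::metric_space set"
  assumes "A \<noteq> {}" "0 \<le> K" "\<And>a. a \<in> A \<Longrightarrow> u \<le> K * dist y a"
  shows "u \<le> K * infdist y A"
proof (cases "K = 0")
  case True
  then show ?thesis using assms by auto
next
  case False
  then have K: "K > 0" using assms(2) by simp
  have "u / K \<le> infdist y A"
    unfolding infdist_notempty[OF assms(1)]
    by (rule cINF_greatest[OF assms(1)]) (use assms(3) K in \<open>simp add: field_simps\<close>)
  then show ?thesis using K by (simp add: field_simps)
qed

lemma infdist_approx_twice:
  fixes A :: "'a::metric_space set"
  assumes "A \<noteq> {}" "infdist y A > 0"
  obtains a where "a \<in> A" "dist y a \<le> 2 * infdist y A"
proof -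
  have "\<exists>a\<in>A. dist y a < 2 * infdist y A"
    using assms cInf_lessD[of "dist y ` A" "2 * infdist y A"] by (auto simp: infdist_notempty)
  then show ?thesis using that less_imp_le by blast
qed

subsection \<open>Composite convex problems\<close>

locale composite_problem =
  fixes f :: "'a::{real_inner, complete_space} \<Rightarrow> real"
    and gradf :: "'a \<Rightarrow> 'a"
    and hessf :: "'a \<Rightarrow> 'a \<Rightarrow>\<^sub>L 'a"
    and \<Psi> :: "'a \<Rightarrow> ereal"
    and L :: real
  assumes f_convex: "convex_on UNIV f"
    and f_grad: "\<And>z. GDERIV f z :> gradf z"
    and f_hess: "\<And>z. (gradf has_derivative blinfun_apply (hessf z)) (at z)"
    and L_pos: "L > 0"
    and grad_lipschitz: "L-lipschitz_on UNIV gradf"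
    and Psi: "convex_fun \<Psi>" "proper_fun \<Psi>" "closed_fun \<Psi>"
    and S_nonempty: "solutions gradf \<Psi> \<noteq> {}"
begin

abbreviation "F \<equiv> objective f \<Psi>"
abbreviation "r \<equiv> residual gradf \<Psi>"
abbreviation "S \<equiv> solutions gradf \<Psi>"
abbreviation "pg \<equiv> prox_grad_step gradf \<Psi> L"

lemma r_nonneg: "0 \<le> r y" by (simp add: residual_def)

section \<open>Estimates for the smooth part\<close>

lemma grad_lip: "norm (gradf y - gradf z) \<le> L * norm (y - z)"
  using lipschitz_onD[OF grad_lipschitz, of y z] by (simp add: dist_norm)

lemma f_line_deriv:
  "((\<lambda>t. f (y + t *\<^sub>R h)) has_real_derivative (gradf (y + t *\<^sub>R h) \<bullet> h)) (at t)"
proof -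
  have "((\<lambda>t. y + t *\<^sub>R h) has_derivative (\<lambda>u. u *\<^sub>R h)) (at t)"
    by (auto intro!: derivative_eq_intros)
  moreover have "(f has_derivative (\<lambda>u. gradf (y + t *\<^sub>R h) \<bullet> u)) (at (y + t *\<^sub>R h))"
    using f_grad[of "y + t *\<^sub>R h"] by (simp add: gderiv_def inner_commute)
  ultimately have "((\<lambda>t. f (y + t *\<^sub>R h)) has_derivative (\<lambda>u. gradf (y + t *\<^sub>R h) \<bullet> (u *\<^sub>R h))) (at t)"
    by (rule has_derivative_compose)
  moreover have "(\<lambda>u. gradf (y + t *\<^sub>R h) \<bullet> (u *\<^sub>R h)) = (*) (gradf (y + t *\<^sub>R h) \<bullet> h)"
    by (simp add: fun_eq_iff)
  ultimately show ?thesis unfolding has_field_derivative_def by simp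
qed

lemma f_tangent: "f y + gradf y \<bullet> (z - y) \<le> f z"
proof -
  let ?g = "\<lambda>t::real. f (y + t *\<^sub>R (z - y))"
  have "convex_on UNIV ?g"
  proof (rule convex_onI)
    fix t u v :: real assume t: "0 < t" "t < 1"
    have "y + ((1 - t) *\<^sub>R u + t *\<^sub>R v) *\<^sub>R (z - y)
      = (1 - t) *\<^sub>R (y + u *\<^sub>R (z - y)) + t *\<^sub>R (y + v *\<^sub>R (z - y))"
      by (simp add: algebra_simps)
    then show "?g ((1 - t) *\<^sub>R u + t *\<^sub>R v) \<le> (1 - t) * ?g u + t * ?g v"
      using convex_onD[OF f_convex, of t] t by simp
  qed simp
  from convex_on_imp_above_tangent[OF this, of 0 1 "gradf y \<bullet> (z - y)"]
  show ?thesis using f_line_deriv[of y "z - y" 0] by simp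
qed

text \<open>The descent lemma. Along the segment, \<open>f\<close> minus its linear part and minus
  the quadratic term has nonpositive derivative, by the Lipschitz bound on the gradient.\<close>

lemma f_descent: "f z \<le> f y + gradf y \<bullet> (z - y) + L/2 * (norm (z - y))\<^sup>2"
proof -
  define h where "h = z - y"
  define g where "g t = f (y + t *\<^sub>R h) - t * (gradf y \<bullet> h) - L/2 * t\<^sup>2 * (norm h)\<^sup>2" for t
  have "\<exists>D. (g has_real_derivative D) (at t) \<and> D \<le> 0" if t: "0 \<le> t" for t
  proof (intro exI conjI)
    show "(g has_real_derivative gradf (y + t *\<^sub>R h) \<bullet> h - gradf y \<bullet> h - L * t * (norm h)\<^sup>2) (at t)"
      unfolding g_def by (rule derivative_eq_intros f_line_deriv refl | simp)+
    have "(gradf (y + t *\<^sub>R h) - gradf y) \<bullet> h \<le> norm (gradf (y + t *\<^sub>R h) - gradf y) * norm h"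
      by (rule norm_cauchy_schwarz)
    also have "\<dots> \<le> (L * norm (t *\<^sub>R h)) * norm h"
      using grad_lip[of "y + t *\<^sub>R h" y] by (intro mult_right_mono) auto
    also have "\<dots> = L * t * (norm h)\<^sup>2" using t by (simp add: power2_eq_square)
    finally show "gradf (y + t *\<^sub>R h) \<bullet> h - gradf y \<bullet> h - L * t * (norm h)\<^sup>2 \<le> 0"
      by (simp add: inner_diff_left)
  qed
  then have "g 1 \<le> g 0" by (intro DERIV_nonpos_imp_nonincreasing[of 0 1 g]) auto
  then show ?thesis by (simp add: g_def h_def)
qed

text \<open>Difference quotients of an \<open>L\<close>-Lipschitz map are bounded by
  \<open>L\<close>; the arbitrary \<open>e\<close> absorbs the remainder of
  differentiability.\<close>

lemma norm_hess_le: "norm (hessf z) \<le> L"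
proof (rule norm_blinfun_bound)
  fix h :: 'a
  have "norm (hessf z h) \<le> L * norm h + e" if e: "e > 0" for e
  proof (cases "h = 0")
    case False
    define e' where "e' = e / norm h"
    have e': "e' > 0" "e' * norm h = e" using e False by (auto simp: e'_def)
    obtain d where d: "d > 0" "\<And>y. norm (y - z) < d \<Longrightarrow>
        norm (gradf y - gradf z - hessf z (y - z)) \<le> e' * norm (y - z)"
      using f_hess[of z] e' unfolding has_derivative_at_alt by blast
    define t where "t = d / (2 * norm h)"
    have t: "t > 0" "norm (t *\<^sub>R h) < d" using d(1) False by (auto simp: t_def)
    have "norm (hessf z (t *\<^sub>R h)) \<le> norm (gradf (z + t *\<^sub>R h) - gradf z)
        + norm (gradf (z + t *\<^sub>R h) - gradf z - hessf z (t *\<^sub>R h))"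
      by (metis norm_triangle_sub norm_minus_commute)
    also have "\<dots> \<le> L * norm (t *\<^sub>R h) + e' * norm (t *\<^sub>R h)"
      using grad_lip[of "z + t *\<^sub>R h" z] d(2)[of "z + t *\<^sub>R h"] t by (intro add_mono) auto
    finally have "t * norm (hessf z h) \<le> t * (L * norm h + e' * norm h)"
      using t by (simp add: blinfun.scaleR_right algebra_simps)
    then show ?thesis using t e' by simp
  qed (use e in simp)
  then show "norm (hessf z h) \<le> L * norm h" by (rule field_le_epsilon)
qed (use L_pos in simp)

lemma grad_linearization:
  assumes "\<And>w. w \<in> closed_segment a b \<Longrightarrow> norm (hessf w - hessf a) \<le> B"
  shows "norm (gradf b - gradf a - hessf a (b - a)) \<le> norm (b - a) * B"
proof (rule differentiable_bound_linearization
    [where S = "closed_segment a b" and f' = "\<lambda>w. blinfun_apply (hessf w)" and ?x0.0 = a])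
  show "a + t *\<^sub>R (b - a) \<in> closed_segment a b" if "t \<in> {0..1}" for t
    using that unfolding in_segment by (intro exI[of _ t]) (auto simp: algebra_simps)
  show "(gradf has_derivative hessf w) (at w within closed_segment a b)" for w
    using f_hess has_derivative_at_withinI by blast
  show "onorm (blinfun_apply (hessf w) - blinfun_apply (hessf a)) \<le> B"
    if "w \<in> closed_segment a b" for w
    using assms[OF that] by (simp add: norm_blinfun.rep_eq minus_blinfun.rep_eq fun_diff_def)
qed auto

section \<open>Convexity, closedness and subgradients of \<open>F\<close>\<close>

lemma objective_eq_ereal: "F z = ereal a \<longleftrightarrow> \<Psi> z = ereal (a - f z)"
  by (cases "\<Psi> z") (auto simp: objective_def)

lemma objective_le_ereal: "F z \<le> ereal a \<longleftrightarrow> \<Psi> z \<le> ereal (a - f z)"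
  by (cases "\<Psi> z") (auto simp: objective_def)

lemma objective_proper: "proper_fun F"
proof -
  have "F z \<noteq> -\<infinity>" for z using Psi(2) by (auto simp: proper_fun_def objective_def)
  moreover obtain z where "\<Psi> z \<noteq> \<infinity>" using Psi(2) by (auto simp: proper_fun_def)
  then have "F z \<noteq> \<infinity>" by (simp add: objective_def)
  ultimately show ?thesis unfolding proper_fun_def by blast
qed

lemma f_continuous: "continuous_on UNIV f"
proof -
  have "isCont f z" for z
    using f_grad[of z] unfolding gderiv_def by (rule has_derivative_continuous)
  then show ?thesis by (simp add: continuous_on_eq_continuous_at)
qed

lemma objective_closed: "closed_fun F"
proof -
  have "ereal_epigraph F = (\<lambda>w. (fst w, snd w - f (fst w))) -` ereal_epigraph \<Psi>"
    by (auto simp: ereal_epigraph_def objective_le_ereal)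
  moreover have "closed ((\<lambda>w. (fst w, snd w - f (fst w))) -` ereal_epigraph \<Psi>)"
    using Psi(3) unfolding closed_fun_def
    by (intro closed_vimage) (auto intro!: continuous_intros continuous_on_compose2[OF f_continuous])
  ultimately show ?thesis by (simp add: closed_fun_def)
qed

lemma objective_convex: "convex_fun F"
  unfolding convex_fun_def
proof (rule convexI)
  fix v w :: "'a \<times> real" and s t :: real
  assume v: "v \<in> ereal_epigraph F" and w: "w \<in> ereal_epigraph F"
    and st: "0 \<le> s" "0 \<le> t" "s + t = 1"
  obtain y a z b where vw: "v = (y, a)" "w = (z, b)" by (cases v, cases w)
  have s: "s = 1 - t" using st by simp
  have e: "s *\<^sub>R y + t *\<^sub>R z = y + t *\<^sub>R (z - y)" by (simp add: s algebra_simps)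
  have "\<Psi> (y + t *\<^sub>R (z - y)) \<le> ereal ((a - f y) + t * ((b - f z) - (a - f y)))"
    using v w vw st by (intro convex_funD[OF Psi(1)]) (auto simp: ereal_epigraph_def objective_le_ereal)
  moreover have "f (s *\<^sub>R y + t *\<^sub>R z) \<le> s * f y + t * f z"
    using convex_onD[OF f_convex, of t y z] st by (simp add: s)
  then have "(a - f y) + t * ((b - f z) - (a - f y)) \<le> (s * a + t * b) - f (y + t *\<^sub>R (z - y))"
    unfolding e by (simp add: s algebra_simps)
  ultimately have "\<Psi> (y + t *\<^sub>R (z - y)) \<le> ereal ((s * a + t * b) - f (y + t *\<^sub>R (z - y)))"
    by (meson ereal_less_eq(3) order_trans)
  then show "s *\<^sub>R v + t *\<^sub>R w \<in> ereal_epigraph F"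
    by (simp add: vw ereal_epigraph_def objective_le_ereal e)
qed

lemma objective_subgradientI:
  assumes "is_subgradient \<Psi> z w"
  shows "is_subgradient F z (gradf z + w)"
proof -
  obtain a where a: "\<Psi> z = ereal a" using assms by (rule is_subgradient_finite)
  show ?thesis
  proof (rule is_subgradientI[OF objective_proper])
    show "F z = ereal (f z + a)" by (simp add: objective_def a)
    fix y b assume "F y = ereal b"
    then have "\<Psi> y = ereal (b - f y)" by (simp add: objective_eq_ereal)
    from is_subgradientD[OF assms a this] f_tangent[of z y]
    show "f z + a + (gradf z + w) \<bullet> (y - z) \<le> b" by (simp add: inner_add_left)
  qed
qed

text \<open>The gradient of \<open>f\<close> can be split off from a subgradient of
  \<open>F\<close>. Convexity of \<open>\<Psi>\<close> and the descent lemma on the segment from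
  \<open>z\<close> to \<open>y\<close> leave an error of order \<open>t\<^sup>2\<close>, which
  vanishes after division by \<open>t\<close>.\<close>

lemma objective_subgradientD:
  assumes "is_subgradient F z v"
  shows "is_subgradient \<Psi> z (v - gradf z)"
proof -
  obtain a where a: "F z = ereal a" using assms by (rule is_subgradient_finite)
  then have Pz: "\<Psi> z = ereal (a - f z)" by (simp add: objective_eq_ereal)
  show ?thesis
  proof (rule is_subgradientI[OF Psi(2) Pz])
    fix y b assume b: "\<Psi> y = ereal b"
    let ?e = "a - f z + (v - gradf z) \<bullet> (y - z) - b"
    have "?e \<le> t * (L/2 * (norm (y - z))\<^sup>2)" if t: "0 < t" "t \<le> 1" for t
    proof -
      let ?w = "z + t *\<^sub>R (y - z)"
      have "\<Psi> ?w \<le> ereal (a - f z + t * (b - (a - f z)))"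
        using convex_funD[OF Psi(1), of z "a - f z" y b t] Pz b t by simp
      moreover obtain c where c: "F ?w = ereal c" 
        using calculation objective_proper by (cases "F ?w"; cases "\<Psi> ?w") (auto simp: objective_def proper_fun_def)
      ultimately have "c - f ?w \<le> a - f z + t * (b - (a - f z))"
        by (simp add: objective_eq_ereal)
      moreover have "a + v \<bullet> (?w - z) \<le> c" by (rule is_subgradientD[OF assms a c])
      moreover have "f ?w \<le> f z + gradf z \<bullet> (?w - z) + L/2 * (norm (?w - z))\<^sup>2"
        by (rule f_descent)
      moreover have "?w - z = t *\<^sub>R (y - z)" by simp
      ultimately have "c - f ?w \<le> a - f z + t * (b - (a - f z))"
        and "a + t * (v \<bullet> (y - z)) \<le> c"
        and "f ?w \<le> f z + t * (gradf z \<bullet> (y - z)) + L/2 * (t\<^sup>2 * (norm (y - z))\<^sup>2)"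
        by (simp_all add: power_mult_distrib)
      moreover have "t * ?e = t * (a - f z - b) + t * (v \<bullet> (y - z)) - t * (gradf z \<bullet> (y - z))"
        by (simp add: inner_diff_left algebra_simps)
      moreover have "t * (t * (L/2 * (norm (y - z))\<^sup>2)) = L/2 * (t\<^sup>2 * (norm (y - z))\<^sup>2)"
        by (simp add: power2_eq_square)
      moreover have "t * (b - (a - f z)) = - (t * (a - f z - b))" by (simp add: algebra_simps)
      ultimately have "t * ?e \<le> t * (t * (L/2 * (norm (y - z))\<^sup>2))" by linarith
      then show ?thesis using t by simp
    qed
    then have "?e \<le> 0" by (rule nonpos_if_le_small_multiples)
    then show "a - f z + (v - gradf z) \<bullet> (y - z) \<le> b" by simp
  qed
qed

section \<open>The residual and the solution set\<close>

text \<open>\<open>z\<close> is the proximal point of \<open>z + w\<close>, and nonexpansiveness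
  compares it with the proximal point in the residual. So a small subgradient of \<open>F\<close>
  forces a small residual.\<close>

lemma residual_le_subgradient:
  assumes "is_subgradient \<Psi> z w"
  shows "r z \<le> norm (gradf z + w)"
proof -
  have "prox \<Psi> (z + w) = z" using assms by (intro prox_eqI[OF Psi(2)]) simp
  then have "r z = norm (prox \<Psi> (z + w) - prox \<Psi> (z - gradf z))" by (simp add: residual_def)
  also have "\<dots> \<le> norm (z + w - (z - gradf z))" by (rule prox_nonexpansive[OF Psi])
  finally show ?thesis by (simp add: add.commute)
qed

lemma residual_subgradient:
  "is_subgradient \<Psi> (prox \<Psi> (y - gradf y)) ((y - prox \<Psi> (y - gradf y)) - gradf y)"
  using is_subgradient_prox[OF Psi, of "y - gradf y"] by (simp add: algebra_simps)

lemma solution_subgradient: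
  assumes "s \<in> S"
  shows "is_subgradient \<Psi> s (- gradf s)"
  using residual_subgradient[of s] assms by (simp add: solutions_def residual_def)

lemma solution_optimal:
  assumes "s \<in> S" "F s = ereal m"
  shows "ereal m \<le> F y"
  using objective_subgradientI[OF solution_subgradient[OF assms(1)]] assms(2)
  unfolding is_subgradient_def by simp

text \<open>A point of zero residual has 0 as a subgradient of \<open>F\<close>; hence it is a
  global minimizer, and all of them share one finite value.\<close>

lemma solution_finite:
  obtains m where "\<forall>s\<in>S. F s = ereal m" "(INF z. F z) = ereal m"
proof -
  obtain s where s: "s \<in> S" using S_nonempty by blast
  obtain m where m: "F s = ereal m"
    using is_subgradient_finite[OF objective_subgradientI[OF solution_subgradient[OF s]]] .
  have "(INF z. F z) = ereal m"
    using solution_optimal[OF s m] m by (intro antisym INF_greatest) (auto intro: INF_lower2[of s])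
  moreover have "F u = ereal m" if u: "u \<in> S" for u
  proof -
    obtain k where k: "F u = ereal k"
      using is_subgradient_finite[OF objective_subgradientI[OF solution_subgradient[OF u]]] .
    show ?thesis using solution_optimal[OF s m, of u] solution_optimal[OF u k, of s] k m by simp
  qed
  ultimately show ?thesis using that by blast
qed

text \<open>The map taking \<open>y\<close> to \<open>y - prox \<Psi> (y - gradf y)\<close> is
  Lipschitz with constant \<open>2 + L\<close> and vanishes on \<open>S\<close>.\<close>

lemma residual_le_dist:
  assumes "s \<in> S"
  shows "r y \<le> (2 + L) * dist y s"
proof -
  have s: "prox \<Psi> (s - gradf s) = s" using assms by (simp add: solutions_def residual_def)
  have "r y = norm ((y - s) - (prox \<Psi> (y - gradf y) - prox \<Psi> (s - gradf s)))"
    by (simp add: residual_def s)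
  also have "\<dots> \<le> norm (y - s) + norm ((y - gradf y) - (s - gradf s))"
    using prox_nonexpansive[OF Psi] by (meson add_left_mono norm_triangle_ineq4 order_trans)
  also have "norm ((y - gradf y) - (s - gradf s)) \<le> norm (y - s) + norm (gradf y - gradf s)"
    using norm_triangle_ineq4[of "y - s" "gradf y - gradf s"] by (simp add: algebra_simps)
  finally show ?thesis using grad_lip[of y s] by (simp add: dist_norm algebra_simps)
qed

lemma residual_le_infdist: "r y \<le> (2 + L) * infdist y S"
  using residual_le_dist L_pos by (intro le_mult_infdistI[OF S_nonempty]) auto

section \<open>The proximal gradient step with constant \<open>L\<close>\<close>

lemma pg_subgradient: "is_subgradient \<Psi> (pg y) (L *\<^sub>R (y - pg y) - gradf y)"
proof -
  note P = convex_fun_scale[OF L_pos Psi(1)] proper_fun_scale[OF L_pos Psi(2)]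
    closed_fun_scale[OF L_pos Psi(3)]
  have "is_subgradient (\<lambda>z. \<Psi> z / ereal L) (pg y) (y - (1/L) *\<^sub>R gradf y - pg y)"
    unfolding prox_grad_step_def by (rule is_subgradient_prox[OF P])
  then have "is_subgradient \<Psi> (pg y) (L *\<^sub>R (y - (1/L) *\<^sub>R gradf y - pg y))"
    by (rule is_subgradient_scale[OF L_pos Psi(2)])
  moreover have "L *\<^sub>R (y - (1/L) *\<^sub>R gradf y - pg y) = L *\<^sub>R (y - pg y) - gradf y"
    using L_pos by (simp add: algebra_simps)
  ultimately show ?thesis by simp
qed

lemma pg_finite:
  obtains a where "F (pg y) = ereal a"
  using is_subgradient_finite[OF objective_subgradientI[OF pg_subgradient]] by blast

text \<open>The subgradient inequality at \<open>pg y\<close> yields \<open>L\<close> times the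
  squared step length; the descent lemma costs half of it.\<close>

lemma pg_decrease:
  assumes "F y = ereal b" "F (pg y) = ereal a"
  shows "a \<le> b - L/2 * (norm (y - pg y))\<^sup>2"
proof -
  have "\<Psi> y = ereal (b - f y)" "\<Psi> (pg y) = ereal (a - f (pg y))"
    using assms by (auto simp: objective_eq_ereal)
  from is_subgradientD[OF pg_subgradient this(2,1)]
  have "a - f (pg y) + (L * (norm (y - pg y))\<^sup>2 - gradf y \<bullet> (y - pg y)) \<le> b - f y"
    by (simp only: inner_diff_left inner_scaleR_left power2_norm_eq_inner)
  moreover have "f (pg y) \<le> f y - gradf y \<bullet> (y - pg y) + L/2 * (norm (y - pg y))\<^sup>2"
    using f_descent[of "pg y" y] by (simp add: norm_minus_commute inner_diff_right)
  moreover have "L * (norm (y - pg y))\<^sup>2 = L/2 * (norm (y - pg y))\<^sup>2 + L/2 * (norm (y - pg y))\<^sup>2"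
    by simp
  ultimately show ?thesis by linarith
qed

lemma pg_gradient_bound: "norm (gradf (pg y) + (L *\<^sub>R (y - pg y) - gradf y)) \<le> 2 * L * norm (y - pg y)"
proof -
  have "norm (gradf (pg y) + (L *\<^sub>R (y - pg y) - gradf y))
    \<le> norm (gradf (pg y) - gradf y) + norm (L *\<^sub>R (y - pg y))"
    using norm_triangle_ineq[of "gradf (pg y) - gradf y" "L *\<^sub>R (y - pg y)"] by (simp add: algebra_simps)
  then show ?thesis using grad_lip[of "pg y" y] L_pos by (simp add: norm_minus_commute)
qed

lemma pg_residual: "r (pg y) \<le> 2 * L * norm (y - pg y)"
  using residual_le_subgradient[OF pg_subgradient] pg_gradient_bound order_trans by blast

text \<open>Proximal gradient steps with constants 1 and \<open>L\<close> have comparable lengths.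
  Monotonicity applied to their two subgradients gives one quadratic inequality in \<open>D\<close>
  and \<open>R\<close>; dropping either square yields one of the bounds.\<close>

lemma
  shows pg_step_le_residual: "L * norm (y - pg y) \<le> (1 + L) * r y"
    and residual_le_pg_step: "r y \<le> (1 + L) * norm (y - pg y)"
proof -
  define P where "P = prox \<Psi> (y - gradf y)"
  define R where "R = y - P"
  define D where "D = y - pg y"
  have eq: "pg y - P = R - D" by (simp add: R_def D_def)
  have "0 \<le> ((L *\<^sub>R D - gradf y) - (R - gradf y)) \<bullet> (R - D)"
    using is_subgradient_monotone[OF pg_subgradient[of y] residual_subgradient[of y]]
    unfolding D_def[symmetric] P_def[symmetric] R_def[symmetric] eq .
  then have "L * (norm D)\<^sup>2 + (norm R)\<^sup>2 \<le> (1 + L) * (D \<bullet> R)"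
    by (simp add: inner_diff_left inner_diff_right power2_norm_eq_inner inner_commute algebra_simps)
  also have "\<dots> \<le> (1 + L) * (norm D * norm R)"
    using L_pos norm_cauchy_schwarz by (intro mult_left_mono) auto
  finally have main: "L * (norm D)\<^sup>2 + (norm R)\<^sup>2 \<le> (1 + L) * (norm D * norm R)" .
  have "L * (norm D)\<^sup>2 \<le> (1 + L) * (norm D * norm R)"
    using main zero_le_power2[of "norm R"] by linarith
  then have "norm D * (L * norm D) \<le> norm D * ((1 + L) * norm R)"
    by (simp add: power2_eq_square algebra_simps)
  then have 1: "L * norm D \<le> (1 + L) * norm R"
    using L_pos by (cases "D = 0") auto
  have "0 \<le> L * (norm D)\<^sup>2" using L_pos by simp
  then have "(norm R)\<^sup>2 \<le> (1 + L) * (norm D * norm R)" using main by linarith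
  then have "norm R * norm R \<le> norm R * ((1 + L) * norm D)"
    by (simp add: power2_eq_square algebra_simps)
  then have 2: "norm R \<le> (1 + L) * norm D"
    using L_pos by (cases "R = 0") auto
  have "r y = norm R" by (simp add: residual_def R_def P_def)
  with 1 2 show "L * norm (y - pg y) \<le> (1 + L) * r y" "r y \<le> (1 + L) * norm (y - pg y)"
    by (simp_all add: D_def)
qed

lemma pg_residual_le: "r (pg y) \<le> 2 * (1 + L) * r y"
  using pg_residual[of y] pg_step_le_residual[of y] by (simp add: algebra_simps)

text \<open>\<open>F\<close> has a subgradient of norm \<open>O(r y)\<close> at \<open>pg y\<close>,
  so convexity bounds the gap by residual times distance. This product form makes the gap small
  enough for the unit step.\<close>

lemma pg_gap:
  assumes "F (pg y) = ereal a" "(INF z. F z) = ereal m"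
  shows "a - m \<le> 2 * (1 + L) * r y * infdist (pg y) S"
proof (rule le_mult_infdistI[OF S_nonempty])
  show "0 \<le> 2 * (1 + L) * r y" using L_pos r_nonneg by simp
  fix s assume s: "s \<in> S"
  obtain m' where "\<forall>s\<in>S. F s = ereal m'" "(INF z. F z) = ereal m'"
    by (rule solution_finite)
  then have Fs: "F s = ereal m" using s assms(2) by simp
  let ?v = "gradf (pg y) + (L *\<^sub>R (y - pg y) - gradf y)"
  have "a + ?v \<bullet> (s - pg y) \<le> m"
    by (rule is_subgradientD[OF objective_subgradientI[OF pg_subgradient] assms(1) Fs])
  moreover have "- (?v \<bullet> (s - pg y)) \<le> norm ?v * norm (s - pg y)"
    using Cauchy_Schwarz_ineq2[of ?v "s - pg y"] by linarith
  moreover have "norm ?v \<le> 2 * (1 + L) * r y"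
    using pg_gradient_bound[of y] pg_step_le_residual[of y] by (simp add: algebra_simps)
  then have "norm ?v * norm (s - pg y) \<le> 2 * (1 + L) * r y * dist (pg y) s"
    by (simp add: mult_right_mono dist_norm norm_minus_commute)
  ultimately show "a - m \<le> 2 * (1 + L) * r y * dist (pg y) s" by linarith
qed

text \<open>A proximal gradient step from \<open>y\<close> cannot go below \<open>m\<close>, so its
  guaranteed decrease is at most the gap. Residuals along the run stay bounded for this
  reason.\<close>

lemma residual_sq_le_gap:
  assumes "F y = ereal b" "(INF z. F z) = ereal m"
  shows "L/2 * (r y)\<^sup>2 \<le> (1 + L)\<^sup>2 * (b - m)"
proof -
  obtain a where a: "F (pg y) = ereal a" by (rule pg_finite)
  have "ereal m \<le> ereal a" using a assms(2) by (metis INF_lower UNIV_I)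
  then have "L/2 * (norm (y - pg y))\<^sup>2 \<le> b - m" using pg_decrease[OF assms(1) a] by simp
  have "(r y)\<^sup>2 \<le> ((1 + L) * norm (y - pg y))\<^sup>2"
    using residual_le_pg_step r_nonneg by (intro power_mono) auto
  then have "L/2 * (r y)\<^sup>2 \<le> L/2 * ((1 + L) * norm (y - pg y))\<^sup>2"
    using L_pos by (intro mult_left_mono) auto
  also have "\<dots> = (1 + L)\<^sup>2 * (L/2 * (norm (y - pg y))\<^sup>2)" by (simp add: power_mult_distrib)
  also have "\<dots> \<le> (1 + L)\<^sup>2 * (b - m)"
    using \<open>L/2 * (norm (y - pg y))\<^sup>2 \<le> b - m\<close> by (intro mult_left_mono) auto
  finally show ?thesis .
qed

text \<open>One proximal step for \<open>\<lambda> F\<close> with \<open>\<lambda> = d powr (1 - 1/q)\<close> moves \<open>y\<close> by \<open>\<lambda> v\<close>, where \<open>v\<close>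
  is a subgradient at the new point \<open>z\<close>, and decreases \<open>F\<close> by \<open>\<lambda> v\<^sup>2\<close> at least. Either the step
  has length at least \<open>d / 2\<close>, or \<open>z\<close> still has distance \<open>d / 2\<close> from \<open>S\<close> and the error
  bound makes \<open>v\<close> large.\<close>
lemma growth:
  assumes kq: "\<kappa> > 0" "q > 0"
    and eb: "\<And>z. r z \<le> \<epsilon> \<Longrightarrow> infdist z S \<le> \<kappa> * r z powr q"
    and F: "F y = ereal b" "(INF z. F z) = ereal m"
    and d: "infdist y S > 0" "2 * (2 + L) * infdist y S \<le> \<epsilon>"
  shows "min (1/4) ((1 / (2 * \<kappa>)) powr (2 / q)) * infdist y S powr ((q + 1) / q) \<le> b - m"
proof -
  define D where "D = infdist y S"
  \<comment> \<open>The reciprocal of the proximal parameter. Its exponent is chosen so that both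
    cases below end with the power \<open>(q + 1) / q\<close> of \<open>D\<close>.\<close>
  define k where "k = D powr (1 / q - 1)"
  have D: "D > 0" and k: "k > 0" using d by (auto simp: D_def k_def)
  obtain z where "is_subgradient (\<lambda>z. F z / ereal k) z (y - z)"
    using prox_point_exists[OF convex_fun_scale[OF k objective_convex]
        proper_fun_scale[OF k objective_proper] closed_fun_scale[OF k objective_closed]] by blast
  then have sub: "is_subgradient F z (k *\<^sub>R (y - z))"
    by (rule is_subgradient_scale[OF k objective_proper])
  obtain a where a: "F z = ereal a" using sub by (rule is_subgradient_finite)
  have "m \<le> a" using a F(2) by (metis INF_lower UNIV_I ereal_less_eq(3))
  moreover have "a + k * (norm (y - z))\<^sup>2 \<le> b"
    using is_subgradientD[OF sub a F(1)] by (simp add: power2_norm_eq_inner)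
  ultimately have dec: "k * (norm (y - z))\<^sup>2 \<le> b - m" by linarith
  have rz: "r z \<le> k * norm (y - z)"
    using residual_le_subgradient[OF objective_subgradientD[OF sub]] k by simp
  show ?thesis
  proof (cases "norm (y - z) \<ge> D / 2")
    case True
    have "(q + 1) / q = (1 / q - 1) + 2" using kq by (simp add: field_simps)
    moreover have "D powr 2 = D\<^sup>2" using D by simp
    ultimately have "D powr ((q + 1) / q) = k * D\<^sup>2"
      by (simp only: k_def powr_add)
    then have "1/4 * D powr ((q + 1) / q) = k * (D/2)\<^sup>2" by (simp add: power2_eq_square)
    also have "\<dots> \<le> k * (norm (y - z))\<^sup>2"
      using True k D by (intro mult_left_mono power_mono) auto
    finally have "1/4 * D powr ((q + 1) / q) \<le> b - m" using dec by linarith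
    moreover have "min (1/4) ((1 / (2 * \<kappa>)) powr (2 / q)) * D powr ((q + 1) / q) \<le> 1/4 * D powr ((q + 1) / q)"
      by (intro mult_right_mono) auto
    ultimately show ?thesis by (simp add: D_def)
  next
    case False
    have 1: "infdist z S \<le> D + dist y z"
      unfolding D_def using infdist_triangle[of z S y] by (simp add: dist_commute)
    \<comment> \<open>The error bound is used at \<open>z\<close>, not at \<open>y\<close>, which
      accounts for the factor 2 in the smallness assumption on the distance.\<close>
    have "infdist z S \<le> 2 * D" using 1 False D by (simp add: dist_norm)
    then have "(2 + L) * infdist z S \<le> (2 + L) * (2 * D)" using L_pos by (intro mult_left_mono) auto
    then have "r z \<le> \<epsilon>" using residual_le_infdist[of z] d(2) by (simp add: D_def algebra_simps)
    from eb[OF this] have e: "infdist z S \<le> \<kappa> * r z powr q" .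
    have "D \<le> infdist z S + dist y z" unfolding D_def by (rule infdist_triangle)
    then have "D / 2 \<le> \<kappa> * r z powr q" using False e by (simp add: dist_norm)
    also have "\<dots> \<le> \<kappa> * (k * norm (y - z)) powr q"
      using rz r_nonneg kq by (intro mult_left_mono powr_mono2) auto
    finally have "D * (1 / (2 * \<kappa>)) \<le> (k * norm (y - z)) powr q" using kq by (simp add: field_simps)
    then have "(D * (1 / (2 * \<kappa>))) powr (2 / q) \<le> ((k * norm (y - z)) powr q) powr (2 / q)"
      using D kq by (intro powr_mono2) auto
    also have "\<dots> = (k * norm (y - z)) powr 2" using kq by (simp add: powr_powr)
    also have "\<dots> = k * (k * (norm (y - z))\<^sup>2)" using k by (simp add: power2_eq_square)
    also have "\<dots> \<le> k * (b - m)" using dec k by (intro mult_left_mono) auto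
    finally have "D powr (2 / q) * (1 / (2 * \<kappa>)) powr (2 / q) \<le> k * (b - m)"
      using D kq by (simp only: powr_mult)
    moreover have "2 / q = (1 / q - 1) + (q + 1) / q" using kq by (simp add: field_simps)
    then have "D powr (2 / q) = k * D powr ((q + 1) / q)"
      by (simp only: k_def powr_add)
    ultimately have "k * ((1 / (2 * \<kappa>)) powr (2 / q) * D powr ((q + 1) / q)) \<le> k * (b - m)"
      by (simp only: mult.assoc mult.commute mult.left_commute)
    then have "(1 / (2 * \<kappa>)) powr (2 / q) * D powr ((q + 1) / q) \<le> b - m"
      using k by (simp only: mult_le_cancel_left_pos)
    moreover have "min (1/4) ((1 / (2 * \<kappa>)) powr (2 / q)) * D powr ((q + 1) / q)
        \<le> (1 / (2 * \<kappa>)) powr (2 / q) * D powr ((q + 1) / q)"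
      by (intro mult_right_mono) auto
    ultimately show ?thesis by (simp add: D_def)
  qed
qed

end

text \<open>The product \<open>\<mu> * norm u\<close> is bounded instead of \<open>norm u\<close>,
  so that the constant does not blow up as \<open>\<mu>\<close> tends to 0. Coercivity turns the
  variational inequality into a quadratic one for this product.\<close>

lemma regularized_inequality_bound:
  fixes H :: "'a::real_inner \<Rightarrow>\<^sub>L 'a"
  assumes coercive: "\<mu> * (norm u)\<^sup>2 \<le> H u \<bullet> u" and \<mu>: "0 \<le> \<mu>" "\<mu> \<le> M"
    and vi: "0 \<le> (b - H u) \<bullet> (u - e)"
    and A: "norm b \<le> A" "norm e \<le> A" and h: "norm H \<le> h"
  shows "\<mu> * norm u \<le> (1 + h + M) * A"
proof (rule ccontr)
  assume neg: "\<not> \<mu> * norm u \<le> (1 + h + M) * A"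
  define X where "X = \<mu> * norm u"
  have nonneg: "0 \<le> A" "0 \<le> h" "0 \<le> M" "0 \<le> X"
    using order_trans[OF norm_ge_zero A(1)] order_trans[OF norm_ge_zero h] \<mu> by (auto simp: X_def)
  have "H u \<bullet> u \<le> b \<bullet> u - b \<bullet> e + H u \<bullet> e"
    using vi by (simp add: inner_diff_left inner_diff_right)
  also have "\<dots> \<le> A * norm u + A * A + h * norm u * A"
  proof -
    have "b \<bullet> u \<le> A * norm u"
      using norm_cauchy_schwarz[of b u] mult_right_mono[OF A(1) norm_ge_zero[of u]] by linarith
    moreover have "- (b \<bullet> e) \<le> A * A"
      using Cauchy_Schwarz_ineq2[of b e] mult_mono[OF A nonneg(1) norm_ge_zero[of e]] by linarith
    moreover have "norm (H u) \<le> h * norm u"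
      using norm_blinfun[of H u] mult_right_mono[OF h norm_ge_zero[of u]] by linarith
    then have "norm (H u) * norm e \<le> h * norm u * A"
      using A nonneg by (intro mult_mono) auto
    then have "H u \<bullet> e \<le> h * norm u * A"
      using norm_cauchy_schwarz[of "H u" e] by linarith
    ultimately show ?thesis by linarith
  qed
  finally have "\<mu> * (norm u)\<^sup>2 \<le> (1 + h) * A * norm u + A * A"
    using coercive by (simp add: algebra_simps)
  \<comment> \<open>Multiplication by \<open>\<mu>\<close> makes the estimate quadratic in
    \<open>X\<close>. An \<open>X\<close> above the claimed bound also exceeds \<open>A\<close>, so
    one factor \<open>A\<close> in the last term can be replaced by \<open>X\<close>.\<close>
  then have "\<mu> * (\<mu> * (norm u)\<^sup>2) \<le> \<mu> * ((1 + h) * A * norm u + A * A)"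
    using \<mu> by (intro mult_left_mono)
  also have "\<dots> = (1 + h) * A * X + \<mu> * (A * A)" by (simp add: X_def algebra_simps)
  also have "\<dots> \<le> (1 + h) * A * X + M * (A * A)"
    using \<mu> nonneg by (intro add_left_mono mult_right_mono) auto
  finally have "X * X \<le> (1 + h) * A * X + M * A * A"
    by (simp add: X_def power2_eq_square algebra_simps)
  moreover have X: "(1 + h + M) * A < X" using neg by (simp add: X_def)
  have "1 * A \<le> (1 + h + M) * A" using nonneg by (intro mult_right_mono) auto
  then have AX: "A \<le> X" using X by simp
  then have "M * A * A \<le> M * A * X" using nonneg by (intro mult_left_mono) auto
  ultimately have "X * X \<le> (1 + h + M) * A * X" by (simp add: algebra_simps)
  moreover have "0 \<le> (1 + h + M) * A" using nonneg by simp
  then have "0 < X" using X by linarith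
  ultimately show False using X by simp
qed

text \<open>Both terms must carry the factor \<open>R powr \<rho>\<close>, since the step estimate
  is later divided by the regularization parameter. In the second term the error bound trades
  \<open>D powr (\<rho> / q)\<close> for it, at the cost of \<open>\<rho> / q\<close> in the
  exponent.\<close>

lemma powr_balance:
  fixes D R :: real
  assumes D: "0 < D" "D \<le> 1" and R: "0 < R" "D \<le> \<kappa> * R powr q"
    and pos: "\<kappa> > 0" "q > 0" "0 < \<rho>"
  shows "R powr \<rho> * D + D powr (1 + p)
    \<le> R powr \<rho> * ((1 + \<kappa> powr (\<rho> / q)) * D powr min 1 (1 + p - \<rho> / q))"
proof -
  have "D powr (\<rho> / q) \<le> (\<kappa> * R powr q) powr (\<rho> / q)"
    using D R pos by (intro powr_mono2) auto
  also have "\<dots> = \<kappa> powr (\<rho> / q) * R powr \<rho>"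
    using pos by (simp add: powr_mult powr_powr)
  finally have "D powr (\<rho> / q) * D powr (1 + p - \<rho> / q)
      \<le> (\<kappa> powr (\<rho> / q) * R powr \<rho>) * D powr min 1 (1 + p - \<rho> / q)"
    using D by (intro mult_mono powr_mono') auto
  moreover have "D powr (1 + p) = D powr (\<rho> / q) * D powr (1 + p - \<rho> / q)"
    by (simp add: powr_add[symmetric])
  moreover have "D powr 1 \<le> D powr min 1 (1 + p - \<rho> / q)"
    using D by (intro powr_mono') auto
  then have "R powr \<rho> * D \<le> R powr \<rho> * D powr min 1 (1 + p - \<rho> / q)"
    using D by (intro mult_left_mono) auto
  ultimately show ?thesis by (simp add: algebra_simps)
qed

subsection \<open>The regularized Newton method\<close>

locale newton_problem = composite_problem f gradf hessf \<Psi> L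
  for f :: "'a::{real_inner, complete_space} \<Rightarrow> real" and gradf hessf \<Psi> L +
  fixes \<epsilon> \<kappa> q p \<zeta> \<beta> \<gamma> \<nu> \<rho> c \<delta> :: real
    and x xn :: "nat \<Rightarrow> 'a"
    and J :: "nat \<Rightarrow> 'a \<Rightarrow>\<^sub>L 'a"
    and \<alpha> :: "nat \<Rightarrow> real"
  assumes eps_kappa_q: "\<epsilon> > 0" "\<kappa> > 0" "q > 0"
    and error_bound: "\<And>z. r z \<le> \<epsilon> \<Longrightarrow> infdist z S \<le> \<kappa> * r z powr q"
    and p: "0 < p" "p \<le> 1"
    and zeta: "0 \<le> \<zeta>"
    and hess_hoelder: "\<And>y z. r y \<le> \<epsilon> \<Longrightarrow> r z \<le> \<epsilon> \<Longrightarrow>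
      norm (hessf y - hessf z) \<le> \<zeta> * norm (y - z) powr p"
    and beta: "0 < \<beta>" "\<beta> < 1"
    and gamma: "0 < \<gamma>" "\<gamma> < 1"
    and nu: "0 \<le> \<nu>" "\<nu> < 1"
    and rho: "0 < \<rho>" "\<rho> \<le> 1"
    and c_pos: "c > 0"
    and delta_pos: "\<delta> > 0"
    and run: "newton_run f gradf hessf \<Psi> L \<beta> \<gamma> \<nu> \<rho> c \<delta> x xn J \<alpha>"
begin

abbreviation "d t \<equiv> infdist (x t) S"
abbreviation "step t \<equiv> xn t - x t"
abbreviation "\<mu> t \<equiv> c * r (x t) powr \<rho>"
abbreviation "H t \<equiv> J t + \<mu> t *\<^sub>R id_blinfun"

section \<open>Estimates for a single iteration\<close>

lemma run_residual_pos: "0 < r (x t)"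
  using run by (simp add: newton_run_def Let_def)

lemma run_model_decrease:
  "model (gradf (x t)) (H t) \<Psi> (x t) (xn t) \<le> model (gradf (x t)) (H t) \<Psi> (x t) (x t)"
  using run by (simp add: newton_run_def Let_def)

lemma run_model_residual:
  "model_residual (gradf (x t)) (H t) \<Psi> (x t) (xn t) \<le> \<nu> * min (r (x t) powr (1 + \<rho>)) (r (x t))"
  using run by (simp add: newton_run_def Let_def)

lemma run_psd: "sym_psd (J t)"
  using run by (simp add: newton_run_def Let_def)

lemma run_line_search:
  obtains k where "\<alpha> t = \<beta> ^ k" "step_accepted f gradf \<Psi> L \<gamma> \<delta> (x t) (step t) (\<beta> ^ k)"
    "\<forall>j<k. \<not> step_accepted f gradf \<Psi> L \<gamma> \<delta> (x t) (step t) (\<beta> ^ j)"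
proof -
  have "\<exists>k. \<alpha> t = \<beta> ^ k \<and> step_accepted f gradf \<Psi> L \<gamma> \<delta> (x t) (step t) (\<beta> ^ k) \<and>
      (\<forall>j<k. \<not> step_accepted f gradf \<Psi> L \<gamma> \<delta> (x t) (step t) (\<beta> ^ j))"
    using run by (simp add: newton_run_def Let_def)
  then show ?thesis using that by blast
qed

lemma run_next: "x (Suc t) = pg (x t + \<alpha> t *\<^sub>R step t)"
  using run by (simp add: newton_run_def Let_def trial_point_def)

lemma mu_pos: "0 < \<mu> t"
  using run_residual_pos[of t] c_pos by simp

lemma H_coercive: "\<mu> t * (norm v)\<^sup>2 \<le> H t v \<bullet> v"
proof -
  have "0 \<le> J t v \<bullet> v" using run_psd[of t] unfolding sym_psd_def by blast
  then show ?thesis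
    by (simp add: blinfun.add_left blinfun.scaleR_left inner_add_left power2_norm_eq_inner)
qed

lemma H_norm_le: "norm (H t) \<le> L + norm (J t - hessf (x t)) + \<mu> t"
proof -
  have "norm (H t) \<le> norm (hessf (x t) + (J t - hessf (x t))) + norm (\<mu> t *\<^sub>R (id_blinfun :: 'a \<Rightarrow>\<^sub>L 'a))"
    using norm_triangle_ineq[of "J t" "\<mu> t *\<^sub>R (id_blinfun :: 'a \<Rightarrow>\<^sub>L 'a)"] by simp
  also have "norm (hessf (x t) + (J t - hessf (x t))) \<le> L + norm (J t - hessf (x t))"
    using norm_triangle_ineq[of "hessf (x t)" "J t - hessf (x t)"] norm_hess_le[of "x t"] by linarith
  also have "norm (\<mu> t *\<^sub>R (id_blinfun :: 'a \<Rightarrow>\<^sub>L 'a)) \<le> \<mu> t * 1"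
    using mu_pos[of t] mult_left_mono[OF norm_blinfun_id_le, of "\<mu> t"] by simp
  finally show ?thesis by simp
qed

text \<open>The inexactness of the model minimizer as a vector: its norm is the model residual, and
  at \<open>xn t - err t\<close> a subgradient of \<open>\<Psi>\<close> is known explicitly.\<close>

definition err :: "nat \<Rightarrow> 'a" where
  "err t = xn t - prox \<Psi> (xn t - gradf (x t) - H t (step t))"

lemma err_subgradient: "is_subgradient \<Psi> (xn t - err t) (err t - gradf (x t) - H t (step t))"
  using is_subgradient_prox[OF Psi, of "xn t - gradf (x t) - H t (step t)"]
  by (simp add: err_def algebra_simps)

lemma err_norm: "norm (err t) \<le> \<nu> * r (x t)" "norm (err t) \<le> \<nu> * r (x t) powr (1 + \<rho>)"
proof -
  have "norm (err t) \<le> \<nu> * min (r (x t) powr (1 + \<rho>)) (r (x t))"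
    using run_model_residual[of t] by (simp add: err_def model_residual_def)
  moreover have "\<nu> * min (r (x t) powr (1 + \<rho>)) (r (x t)) \<le> \<nu> * r (x t)"
    "\<nu> * min (r (x t) powr (1 + \<rho>)) (r (x t)) \<le> \<nu> * r (x t) powr (1 + \<rho>)"
    using nu by (auto intro!: mult_left_mono)
  ultimately show "norm (err t) \<le> \<nu> * r (x t)" "norm (err t) \<le> \<nu> * r (x t) powr (1 + \<rho>)"
    by linarith+
qed

text \<open>The two proximal arguments differ by \<open>step t - H t (step t)\<close>, and the
  inexactness consumes only the fraction \<open>\<nu>\<close> of the residual.\<close>

lemma residual_le_step: "(1 - \<nu>) * r (x t) \<le> (2 + norm (H t)) * norm (step t)"
proof -
  let ?P = "prox \<Psi> (x t - gradf (x t))" and ?Q = "prox \<Psi> (xn t - gradf (x t) - H t (step t))"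
  have "x t - ?P = err t - step t + (?Q - ?P)" by (simp add: err_def)
  then have "r (x t) \<le> norm (err t - step t) + norm (?Q - ?P)"
    unfolding residual_def using norm_triangle_ineq by metis
  also have "norm (?Q - ?P) \<le> norm ((xn t - gradf (x t) - H t (step t)) - (x t - gradf (x t)))"
    by (rule prox_nonexpansive[OF Psi])
  also have "(xn t - gradf (x t) - H t (step t)) - (x t - gradf (x t)) = step t - H t (step t)"
    by simp
  also have "norm \<dots> \<le> norm (step t) + norm (H t) * norm (step t)"
    using norm_triangle_ineq4[of "step t" "H t (step t)"] norm_blinfun[of "H t" "step t"] by linarith
  finally have "r (x t) \<le> norm (err t - step t) + norm (step t) + norm (H t) * norm (step t)" by simp
  moreover have "norm (err t - step t) \<le> \<nu> * r (x t) + norm (step t)"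
    using norm_triangle_ineq4[of "err t" "step t"] err_norm(1)[of t] by linarith
  ultimately show ?thesis by (simp add: algebra_simps)
qed

text \<open>Monotonicity is applied to the inexact model point and the proximal point in the
  residual; \<open>err t - R\<close> serves both as \<open>b\<close> and as \<open>e\<close> of the
  general bound.\<close>

lemma step_le_residual:
  assumes "norm (H t) \<le> h" "\<mu> t \<le> M"
  shows "\<mu> t * norm (step t) \<le> (1 + h + M) * (2 * r (x t))"
proof (rule regularized_inequality_bound[OF H_coercive _ assms(2)])
  define R where "R = x t - prox \<Psi> (x t - gradf (x t))"
  have Rn: "norm R = r (x t)" by (simp add: residual_def R_def)
  have "is_subgradient \<Psi> (x t - R) (R - gradf (x t))"
    using residual_subgradient[of "x t"] by (simp add: R_def)
  note mono = is_subgradient_monotone[OF err_subgradient[of t] this]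
  have eq: "err t - gradf (x t) - H t (step t) - (R - gradf (x t)) = err t - R - H t (step t)"
    "xn t - err t - (x t - R) = step t - (err t - R)" by simp_all
  show "0 \<le> (err t - R - H t (step t)) \<bullet> (step t - (err t - R))"
    using mono unfolding eq .
  have "norm (err t) \<le> r (x t)"
    using err_norm(1)[of t] nu mult_right_mono[of \<nu> 1 "r (x t)"] r_nonneg[of "x t"] by linarith
  then show "norm (err t - R) \<le> 2 * r (x t)" "norm (err t - R) \<le> 2 * r (x t)"
    using norm_triangle_ineq4[of "err t" R] Rn by linarith+
qed (use assms mu_pos less_imp_le in auto)

section \<open>Line search and vanishing of the residual\<close>

text \<open>Model decrease and coercivity give a first-order gain of \<open>a * \<mu> t / 2\<close>
  times the squared step length, which has to cover the second-order term of the descent lemma and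
  the required decrease. The concluding proximal gradient step cannot increase
  \<open>F\<close>.\<close>

lemma accept_small_step:
  assumes u: "F (x t) = ereal u" and a: "0 < a" "a \<le> 1"
    and small: "a * (L/2 + \<gamma> * norm (step t) powr \<delta>) \<le> \<mu> t / 2"
  shows "step_accepted f gradf \<Psi> L \<gamma> \<delta> (x t) (step t) a"
proof -
  let ?p = "step t" and ?y = "x t + a *\<^sub>R step t"
  define N where "N = (norm ?p)\<^sup>2"
  define P where "P = norm ?p powr \<delta>"
  have Px: "\<Psi> (x t) = ereal (u - f (x t))" using u by (simp add: objective_eq_ereal)
  obtain b where b: "\<Psi> (xn t) = ereal b"
    using run_model_decrease[of t] Psi(2) Px
    by (cases "\<Psi> (xn t)") (auto simp: model_def proper_fun_def)
  define G where "G = gradf (x t) \<bullet> ?p"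
  define Q where "Q = H t ?p \<bullet> ?p"
  have model: "G + Q / 2 + b \<le> u - f (x t)"
    using run_model_decrease[of t] by (simp add: model_def Px b G_def Q_def)
  have NQ: "\<mu> t * N \<le> Q" using H_coercive[of t ?p] by (simp add: N_def Q_def)
  have "\<Psi> ?y \<le> ereal (u - f (x t) + a * (b - (u - f (x t))))"
    using convex_funD[OF Psi(1), of "x t" "u - f (x t)" "xn t" b a] Px b a by simp
  moreover have "f ?y \<le> f (x t) + a * G + L/2 * (a\<^sup>2 * N)"
    using f_descent[of ?y "x t"] by (simp add: G_def N_def power_mult_distrib)
  moreover obtain v where v: "F ?y = ereal v"
    using calculation(1) objective_proper by (cases "F ?y"; cases "\<Psi> ?y") (auto simp: objective_def proper_fun_def)
  ultimately have "v \<le> u + a * (b - (u - f (x t))) + a * G + L/2 * (a\<^sup>2 * N)"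
    by (simp add: objective_eq_ereal)
  also have "\<dots> = u + a * (G + b - (u - f (x t))) + L/2 * (a\<^sup>2 * N)" by (simp add: algebra_simps)
  also have "a * (G + b - (u - f (x t))) \<le> a * (- (Q / 2))"
    using model a by (intro mult_left_mono) auto
  also have "a * (- (Q / 2)) \<le> a * (- (\<mu> t * N / 2))"
    using NQ a by (intro mult_left_mono) auto
  finally have v_le: "v \<le> u + a * (- (\<mu> t * N / 2)) + L/2 * (a\<^sup>2 * N)" by simp
  have "a * N * (a * (L/2 + \<gamma> * P)) \<le> a * N * (\<mu> t / 2)"
    using small a by (intro mult_left_mono) (auto simp: P_def N_def)
  then have "L/2 * (a\<^sup>2 * N) + \<gamma> * a\<^sup>2 * (N * P) \<le> - (a * (- (\<mu> t * N / 2)))"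
    by (simp add: power2_eq_square algebra_simps)
  with v_le have "v \<le> u - \<gamma> * a\<^sup>2 * (N * P)" by linarith
  moreover have "N * P = norm ?p powr (2 + \<delta>)"
    by (cases "?p = 0") (simp_all add: N_def P_def powr_add)
  moreover obtain w where w: "F (pg ?y) = ereal w" by (rule pg_finite)
  have "0 \<le> L/2 * (norm (?y - pg ?y))\<^sup>2" using L_pos by simp
  then have "w \<le> v" using pg_decrease[OF v w] by linarith
  ultimately show ?thesis
    by (simp add: step_accepted_def trial_point_def w u)
qed

text \<open>The objective may be infinite at the initial point. Every later iterate is a proximal
  gradient point, so finiteness is guaranteed from index 1 on; hence the shifts by
  \<open>Suc\<close> below.\<close>

definition Fval :: "nat \<Rightarrow> real" where "Fval t = real_of_ereal (F (x t))"

lemma Fval_Suc: "F (x (Suc t)) = ereal (Fval (Suc t))"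
proof -
  obtain a where "F (x (Suc t)) = ereal a" unfolding run_next by (rule pg_finite)
  then show ?thesis by (simp add: Fval_def)
qed

lemma step_size_range: "0 < \<alpha> t" "\<alpha> t \<le> 1"
proof -
  obtain k where "\<alpha> t = \<beta> ^ k" by (rule run_line_search)
  then show "0 < \<alpha> t" "\<alpha> t \<le> 1" using beta by (auto intro: power_le_one)
qed

lemma objective_decrease:
  "Fval (Suc (Suc t)) \<le> Fval (Suc t) - \<gamma> * (\<alpha> (Suc t))\<^sup>2 * norm (step (Suc t)) powr (2 + \<delta>)"
proof -
  obtain k where "\<alpha> (Suc t) = \<beta> ^ k"
    and k: "step_accepted f gradf \<Psi> L \<gamma> \<delta> (x (Suc t)) (step (Suc t)) (\<beta> ^ k)"
    by (rule run_line_search)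
  then have "F (x (Suc (Suc t))) \<le> F (x (Suc t)) - ereal (\<gamma> * (\<alpha> (Suc t))\<^sup>2 * norm (step (Suc t)) powr (2 + \<delta>))"
    by (simp add: step_accepted_def trial_point_def run_next[of "Suc t"])
  then show ?thesis by (simp add: Fval_Suc)
qed

text \<open>The last rejected trial is \<open>\<alpha> (Suc t) / \<beta>\<close>, which must violate
  the sufficient condition for acceptance.\<close>

lemma step_size_lower:
  assumes "\<alpha> (Suc t) \<noteq> 1"
  shows "\<beta> * (\<mu> (Suc t) / 2) < \<alpha> (Suc t) * (L/2 + \<gamma> * norm (step (Suc t)) powr \<delta>)"
proof -
  obtain k where k: "\<alpha> (Suc t) = \<beta> ^ k"
    "\<forall>j<k. \<not> step_accepted f gradf \<Psi> L \<gamma> \<delta> (x (Suc t)) (step (Suc t)) (\<beta> ^ j)"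
    by (rule run_line_search)
  then obtain j where j: "k = Suc j" using assms by (cases k) auto
  have "\<not> \<beta> ^ j * (L/2 + \<gamma> * norm (step (Suc t)) powr \<delta>) \<le> \<mu> (Suc t) / 2"
    using accept_small_step[OF Fval_Suc, of "\<beta> ^ j" t] k(2) j beta power_le_one[of \<beta> j] by auto
  then have "\<beta> * (\<mu> (Suc t) / 2) < \<beta> * (\<beta> ^ j * (L/2 + \<gamma> * norm (step (Suc t)) powr \<delta>))"
    unfolding not_le using beta by (intro mult_strict_left_mono)
  then show ?thesis by (simp add: k j mult.assoc)
qed

lemma hessian_error:
  obtains C \<theta> where "C > 0" "\<theta> \<ge> \<rho>"
    "eventually (\<lambda>t. norm (J t - hessf (x t)) \<le> C * r (x t) powr \<theta>) sequentially"
proof -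
  obtain \<theta> where \<theta>: "\<theta> \<ge> \<rho>" "(\<lambda>t. norm (J t - hessf (x t))) \<in> O(\<lambda>t. r (x t) powr \<theta>)"
    using run by (auto simp: newton_run_def)
  obtain C where "C > 0"
    "eventually (\<lambda>t. norm (norm (J t - hessf (x t))) \<le> C * norm (r (x t) powr \<theta>)) sequentially"
    using \<theta>(2) by (rule landau_o.bigE)
  then show ?thesis using that[of C \<theta>] \<theta>(1) by simp
qed

text \<open>Were \<open>r\<close> not to tend to \<open>0\<close>, infinitely many steps would decrease \<open>F\<close> by a fixed amount.\<close>
lemma residual_tendsto_0: "(\<lambda>t. r (x t)) \<longlonglongrightarrow> 0"
proof -
  obtain m where m: "(INF z. F z) = ereal m" by (metis solution_finite)
  have m_le: "m \<le> Fval (Suc t)" for t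
    using INF_lower[of "x (Suc t)" UNIV F] m Fval_Suc[of t] by simp
  define g where "g t = \<gamma> * (\<alpha> (Suc t))\<^sup>2 * norm (step (Suc t)) powr (2 + \<delta>)" for t
  have g_nonneg: "0 \<le> g t" for t using gamma by (simp add: g_def)
  have g_le: "g t \<le> Fval (Suc t) - Fval (Suc (Suc t))" for t
    using objective_decrease[of t] by (simp add: g_def)
  have dec: "decseq (\<lambda>t. Fval (Suc t))"
    unfolding decseq_Suc_iff using g_nonneg g_le by (smt (verit))
  then obtain l where l: "(\<lambda>t. Fval (Suc t)) \<longlonglongrightarrow> l"
    using decseq_convergent[OF dec, of m] m_le by blast
  have "(\<lambda>t. Fval (Suc t) - Fval (Suc (Suc t))) \<longlonglongrightarrow> l - l"
    by (intro tendsto_diff l LIMSEQ_Suc[OF l])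
  then have g0: "g \<longlonglongrightarrow> 0"
    using g_nonneg g_le
    by (intro tendsto_sandwich[of "\<lambda>_. 0" g sequentially "\<lambda>t. Fval (Suc t) - Fval (Suc (Suc t))"])
       auto
  \<comment> \<open>The residuals satisfy \<open>r\<^sup>2 \<le> B - 1\<close>, and
    \<open>2 * r \<le> 1 + r\<^sup>2\<close> turns this into \<open>r \<le> B\<close> without a
    square root.\<close>
  define B where "B = 1 + (1 + L)\<^sup>2 * (Fval 1 - m) / (L/2)"
  have rB: "r (x (Suc t)) \<le> B" for t
  proof -
    have "Fval (Suc t) \<le> Fval 1" using decseqD[OF dec, of 0 t] by simp
    then have "(1 + L)\<^sup>2 * (Fval (Suc t) - m) \<le> (1 + L)\<^sup>2 * (Fval 1 - m)"
      by (intro mult_left_mono) auto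
    then have "L/2 * (r (x (Suc t)))\<^sup>2 \<le> (1 + L)\<^sup>2 * (Fval 1 - m)"
      using residual_sq_le_gap[OF Fval_Suc m, of t] by linarith
    then have "(r (x (Suc t)))\<^sup>2 \<le> B - 1" using L_pos by (simp add: B_def field_simps)
    moreover have "0 \<le> (r (x (Suc t)) - 1)\<^sup>2" by simp
    then have "2 * r (x (Suc t)) \<le> 1 + (r (x (Suc t)))\<^sup>2" by (simp add: power2_diff)
    ultimately show ?thesis using r_nonneg[of "x (Suc t)"] by linarith
  qed
  have B: "0 < B" using rB[of 0] run_residual_pos[of "Suc 0"] by linarith
  obtain C \<theta> where C: "C > 0" "\<theta> \<ge> \<rho>"
    "eventually (\<lambda>t. norm (J t - hessf (x t)) \<le> C * r (x t) powr \<theta>) sequentially"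
    by (rule hessian_error)
  define K where "K = C * B powr \<theta>"
  have JK: "eventually (\<lambda>t. norm (J (Suc t) - hessf (x (Suc t))) \<le> K) sequentially"
    using eventually_compose_filterlim[OF C(3) filterlim_Suc]
  proof eventually_elim
    case (elim t)
    moreover have "C * r (x (Suc t)) powr \<theta> \<le> K"
      unfolding K_def using C(1,2) rho rB r_nonneg by (intro mult_left_mono powr_mono2) auto
    ultimately show ?case by linarith
  qed
  define M where "M = c * B powr \<rho>"
  have muM: "\<mu> (Suc t) \<le> M" for t
    unfolding M_def using c_pos rho rB r_nonneg by (intro mult_left_mono powr_mono2) auto
  define h where "h = L + \<bar>K\<bar> + M"
  have h_pos: "0 < h" using L_pos c_pos B by (simp add: h_def M_def add_pos_nonneg)
  have Hh: "eventually (\<lambda>t. norm (H (Suc t)) \<le> h) sequentially"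
    using JK
  proof eventually_elim
    case (elim t)
    then show ?case using H_norm_le[of "Suc t"] muM[of t] unfolding h_def by linarith
  qed
  have "(\<lambda>t. r (x (Suc t))) \<longlonglongrightarrow> 0"
  proof (rule LIMSEQ_I)
    fix \<eta> :: real assume \<eta>: "0 < \<eta>"
    \<comment> \<open>For large \<open>t\<close> with residual at least \<open>\<eta>\<close>:
      \<open>\<mu>0\<close> is a lower bound for the regularization, \<open>P0\<close> and
      \<open>k\<close> are upper and lower bounds for the step length, and \<open>a0\<close> is a
      lower bound for the step size. The resulting fixed decrease contradicts the convergence of
      \<open>g\<close> to 0.\<close>
    define \<mu>0 where "\<mu>0 = c * \<eta> powr \<rho>"
    define P0 where "P0 = (1 + h + M) * (2 * B) / \<mu>0"
    define k where "k = (1 - \<nu>) * \<eta> / (2 + h)"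
    define W where "W = L/2 + \<gamma> * P0 powr \<delta>"
    define a0 where "a0 = min 1 (\<beta> * (\<mu>0 / 2) / W)"
    have W: "0 < W" using L_pos gamma by (simp add: W_def add_pos_nonneg)
    have pos: "0 < \<mu>0" "0 < k" "0 < a0"
      using \<eta> c_pos nu h_pos W beta by (auto simp: \<mu>0_def k_def a0_def)
    have "eventually (\<lambda>t. g t < \<gamma> * a0\<^sup>2 * k powr (2 + \<delta>)) sequentially"
      using pos gamma by (intro order_tendstoD(2)[OF g0]) auto
    then have "eventually (\<lambda>t. norm (r (x (Suc t)) - 0) < \<eta>) sequentially"
      using Hh
    proof eventually_elim
      case (elim t)
      show ?case
      proof (rule ccontr)
        assume "\<not> norm (r (x (Suc t)) - 0) < \<eta>"
        then have r\<eta>: "\<eta> \<le> r (x (Suc t))" using r_nonneg by simp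
        then have mu: "\<mu>0 \<le> \<mu> (Suc t)"
          unfolding \<mu>0_def using \<eta> c_pos rho by (intro mult_left_mono powr_mono2) auto
        have "(1 - \<nu>) * \<eta> \<le> (1 - \<nu>) * r (x (Suc t))" using r\<eta> nu by (intro mult_left_mono) auto
        also have "\<dots> \<le> (2 + norm (H (Suc t))) * norm (step (Suc t))" by (rule residual_le_step)
        also have "\<dots> \<le> (2 + h) * norm (step (Suc t))" using elim(2) by (intro mult_right_mono) auto
        finally have k_le: "k \<le> norm (step (Suc t))" using h_pos by (simp add: k_def field_simps)
        have "\<mu>0 * norm (step (Suc t)) \<le> \<mu> (Suc t) * norm (step (Suc t))"
          using mu by (intro mult_right_mono) auto
        also have "\<dots> \<le> (1 + h + M) * (2 * r (x (Suc t)))" by (rule step_le_residual[OF elim(2) muM])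
        also have "\<dots> \<le> (1 + h + M) * (2 * B)"
          using rB h_pos muM[of t] mu_pos[of "Suc t"] by (intro mult_left_mono) auto
        finally have P0: "norm (step (Suc t)) \<le> P0" using pos by (simp add: P0_def field_simps)
        have a0: "a0 \<le> \<alpha> (Suc t)"
        proof (cases "\<alpha> (Suc t) = 1")
          case False
          have "\<beta> * (\<mu>0 / 2) \<le> \<beta> * (\<mu> (Suc t) / 2)" using mu beta by simp
          also have "\<dots> \<le> \<alpha> (Suc t) * (L/2 + \<gamma> * norm (step (Suc t)) powr \<delta>)"
            using step_size_lower[OF False] by simp
          also have "\<dots> \<le> \<alpha> (Suc t) * W"
            unfolding W_def using P0 gamma delta_pos step_size_range(1)[of "Suc t"]
            by (intro mult_left_mono add_left_mono powr_mono2) auto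
          finally have "\<beta> * (\<mu>0 / 2) / W \<le> \<alpha> (Suc t)" using W by (simp add: field_simps)
          then show ?thesis by (simp add: a0_def)
        qed (simp add: a0_def)
        have "\<gamma> * a0\<^sup>2 * k powr (2 + \<delta>) \<le> g t"
          unfolding g_def using a0 k_le pos gamma delta_pos
          by (intro mult_mono mult_left_mono power_mono powr_mono2) auto
        then show False using elim(1) by simp
      qed
    qed
    then show "\<exists>no. \<forall>n\<ge>no. norm (r (x (Suc n)) - 0) < \<eta>" by (simp add: eventually_sequentially)
  qed
  then show ?thesis by (rule LIMSEQ_imp_Suc)
qed

subsection \<open>Local convergence\<close>

text \<open>The first term collects inexactness, Hessian approximation and regularization; the
  second is the Hoelder linearization error.\<close>

definition local_err :: "nat \<Rightarrow> real" where
  "local_err t = r (x t) powr \<rho> * d t + d t powr (1 + p)"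

lemma dist_pos: "0 < d t"
proof -
  have "0 < (2 + L) * d t" using residual_le_infdist[of "x t"] run_residual_pos[of t] by linarith
  then show ?thesis using L_pos by (simp add: zero_less_mult_iff)
qed

lemma dist_tendsto_0: "d \<longlonglongrightarrow> 0"
proof (rule tendsto_sandwich[of "\<lambda>_. 0" d sequentially "\<lambda>t. \<kappa> * r (x t) powr q"])
  show "eventually (\<lambda>t. d t \<le> \<kappa> * r (x t) powr q) sequentially"
    using order_tendstoD(2)[OF residual_tendsto_0 eps_kappa_q(1)]
    by eventually_elim (simp add: error_bound)
  have "(\<lambda>t. r (x t) powr q) \<longlonglongrightarrow> 0"
    using residual_tendsto_0 eps_kappa_q(3) r_nonneg
    by (intro tendsto_zero_powrI[where b = q]) auto
  then show "(\<lambda>t. \<kappa> * r (x t) powr q) \<longlonglongrightarrow> 0" using tendsto_mult_right_zero by blast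
qed (simp_all add: infdist_nonneg)

lemma eventually_dist_powr_less:
  assumes "0 < a" "0 < e"
  shows "eventually (\<lambda>t. K * d t powr a < e) sequentially"
proof -
  have "(\<lambda>t. d t powr a) \<longlonglongrightarrow> 0"
    using dist_tendsto_0 assms(1) by (intro tendsto_zero_powrI[where b = a]) (simp_all add: infdist_nonneg)
  then have "(\<lambda>t. K * d t powr a) \<longlonglongrightarrow> 0" by (rule tendsto_mult_right_zero)
  then show ?thesis using assms(2) by (rule order_tendstoD(2))
qed

text \<open>The residual is at most \<open>2 + L\<close> times the distance, so the smallness
  condition keeps the whole segment where the Hessian is Hoelder continuous.\<close>

lemma hoelder_linearization:
  assumes "(2 + L) * (d t + norm v) \<le> \<epsilon>"
  shows "norm (gradf (x t + v) - gradf (x t) - hessf (x t) v) \<le> \<zeta> * norm v powr (1 + p)"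
proof -
  have mem: "r w \<le> \<epsilon>" if "norm (w - x t) \<le> norm v" for w
  proof -
    have "infdist w S \<le> d t + norm v"
      using infdist_triangle[of w S "x t"] that by (simp add: dist_norm)
    then have "(2 + L) * infdist w S \<le> (2 + L) * (d t + norm v)"
      using L_pos by (intro mult_left_mono) auto
    then show ?thesis using residual_le_infdist[of w] assms by linarith
  qed
  have "norm (gradf (x t + v) - gradf (x t) - hessf (x t) (x t + v - x t))
      \<le> norm (x t + v - x t) * (\<zeta> * norm v powr p)"
  proof (rule grad_linearization)
    fix w assume "w \<in> closed_segment (x t) (x t + v)"
    then have w: "norm (w - x t) \<le> norm v"
      using segment_bound(1)[of w "x t" "x t + v"] by simp
    then have "\<zeta> * norm (w - x t) powr p \<le> \<zeta> * norm v powr p"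
      using zeta p by (intro mult_left_mono powr_mono2) auto
    then show "norm (hessf w - hessf (x t)) \<le> \<zeta> * norm v powr p"
      using hess_hoelder[OF mem[OF w] mem[of "x t"]] by simp
  qed
  also have "norm (x t + v - x t) * (\<zeta> * norm v powr p) = \<zeta> * norm v powr (1 + p)"
    by (cases "v = 0") (simp_all add: powr_add)
  finally show ?thesis by simp
qed

lemma residual_powr_le: "r (x t) powr (1 + \<rho>) \<le> (2 + L) * (r (x t) powr \<rho> * d t)"
proof -
  have "r (x t) powr \<rho> * r (x t) \<le> r (x t) powr \<rho> * ((2 + L) * d t)"
    using residual_le_infdist by (intro mult_left_mono) auto
  then show ?thesis using run_residual_pos[of t] by (simp add: powr_add algebra_simps)
qed

text \<open>The step is compared with the displacement \<open>z\<close> to a nearly closest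
  solution. The general bound applies to the difference \<open>u\<close>, with \<open>b\<close> made
  of the four errors \<open>err t\<close>, \<open>w1\<close>, \<open>w2\<close> and
  \<open>\<mu> t *\<^sub>R z\<close>; adding \<open>z\<close> back raises the factor
  \<open>1 + h + M\<close> by 1.\<close>

lemma local_step_bound:
  assumes small: "(2 + L) * (3 * d t) \<le> \<epsilon>"
    and C: "0 \<le> C" "norm (J t - hessf (x t)) \<le> C * r (x t) powr \<rho>"
    and h: "norm (H t) \<le> h" and M: "\<mu> t \<le> M"
  shows "\<mu> t * norm (step t) \<le> (2 + h + M) * ((2 + L + 2 * C + 2 * c + 4 * \<zeta>) * local_err t)"
proof -
  define Q where "Q = r (x t) powr \<rho> * d t"
  define E where "E = d t powr (1 + p)"
  define A where "A = (2 + L + 2 * C + 2 * c + 4 * \<zeta>) * local_err t"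
  have Q: "0 \<le> Q" and E: "0 \<le> E" by (simp_all add: Q_def E_def infdist_nonneg)
  have A_eq: "A = (2 + L) * Q + 2 * C * Q + 2 * c * Q + 4 * \<zeta> * Q
      + ((2 + L) * E + 2 * C * E + 2 * c * E + 4 * \<zeta> * E)"
    by (simp add: A_def local_err_def Q_def E_def algebra_simps)
  have nn: "0 \<le> (2 + L) * Q" "0 \<le> 2 * C * Q" "0 \<le> 2 * c * Q" "0 \<le> 4 * \<zeta> * Q"
      "0 \<le> (2 + L) * E" "0 \<le> 2 * C * E" "0 \<le> 2 * c * E" "0 \<le> 4 * \<zeta> * E"
    using Q E L_pos C zeta c_pos by auto
  obtain s where s: "s \<in> S" "dist (x t) s \<le> 2 * d t"
    using infdist_approx_twice[OF S_nonempty dist_pos] by blast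
  define z where "z = s - x t"
  have z: "norm z \<le> 2 * d t" "s = x t + z"
    using s(2) by (auto simp: z_def dist_norm norm_minus_commute)
  define u where "u = step t - z"
  define w1 where "w1 = gradf s - gradf (x t) - hessf (x t) z"
  define w2 where "w2 = (hessf (x t) - J t) z"
  define b where "b = err t + w1 + w2 - \<mu> t *\<^sub>R z"
  have e: "norm (err t) \<le> (2 + L) * Q"
  proof -
    have "\<nu> * r (x t) powr (1 + \<rho>) \<le> 1 * r (x t) powr (1 + \<rho>)" using nu by (intro mult_right_mono) auto
    then show ?thesis using err_norm(2)[of t] residual_powr_le[of t] by (simp add: Q_def)
  qed
  have w1: "norm w1 \<le> 4 * \<zeta> * E"
  proof -
    have "(2 + L) * (d t + norm z) \<le> (2 + L) * (3 * d t)" using L_pos z by (intro mult_left_mono) auto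
    then have "norm w1 \<le> \<zeta> * norm z powr (1 + p)"
      unfolding w1_def z(2) using small by (intro hoelder_linearization) auto
    also have "\<dots> \<le> \<zeta> * (4 * E)"
    proof (intro mult_left_mono zeta)
      have "norm z powr (1 + p) \<le> (2 * d t) powr (1 + p)" using z p by (intro powr_mono2) auto
      also have "\<dots> = 2 powr (1 + p) * E" by (simp add: E_def powr_mult infdist_nonneg)
      \<comment> \<open>\<open>1 + p \<le> 2\<close> turns the factor 2 of the nearly closest
        solution into the constant 4.\<close>
      also have "(2::real) powr (1 + p) \<le> 2 powr 2" using p by (intro powr_mono) auto
      then have "2 powr (1 + p) * E \<le> 4 * E" using E by (intro mult_right_mono) auto
      finally show "norm z powr (1 + p) \<le> 4 * E" .
    qed
    finally show ?thesis by simp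
  qed
  have w2: "norm w2 \<le> 2 * C * Q"
  proof -
    have "norm w2 \<le> norm (J t - hessf (x t)) * norm z"
      unfolding w2_def using norm_blinfun[of "hessf (x t) - J t" z] by (simp add: norm_minus_commute)
    also have "\<dots> \<le> (C * r (x t) powr \<rho>) * (2 * d t)"
      using C z by (intro mult_mono) auto
    finally show ?thesis by (simp add: Q_def algebra_simps)
  qed
  have mz: "\<mu> t * norm z \<le> 2 * c * Q"
    using mult_left_mono[OF z(1), of "\<mu> t"] mu_pos[of t] by (simp add: Q_def algebra_simps)
  have "norm b \<le> norm (err t) + norm w1 + norm w2 + \<mu> t * norm z"
  proof -
    have "norm b \<le> norm (err t + w1 + w2) + norm (\<mu> t *\<^sub>R z)" unfolding b_def by (rule norm_triangle_ineq4)
    moreover have "norm (err t + w1 + w2) \<le> norm (err t) + norm w1 + norm w2"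
      using norm_triangle_ineq[of "err t + w1" w2] norm_triangle_ineq[of "err t" w1] by linarith
    moreover have "norm (\<mu> t *\<^sub>R z) = \<mu> t * norm z" using mu_pos[of t] by simp
    ultimately show ?thesis by linarith
  qed
  then have bA: "norm b \<le> A" using e w1 w2 mz nn unfolding A_eq by linarith
  have eA: "norm (err t) \<le> A" using e nn unfolding A_eq by linarith
  \<comment> \<open>Since \<open>s = x t + z\<close> is a solution, monotonicity of the subdifferential of \<open>\<Psi>\<close> gives
    a variational inequality for \<open>u\<close> in which only first-order small terms remain besides \<open>H t u\<close>.\<close>
  have "0 \<le> ((err t - gradf (x t) - H t (step t)) - - gradf s) \<bullet> ((xn t - err t) - s)"
    by (rule is_subgradient_monotone[OF err_subgradient solution_subgradient[OF s(1)]])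
  moreover have "(err t - gradf (x t) - H t (step t)) - - gradf s = b - H t u"
    by (simp add: b_def w1_def w2_def u_def blinfun.diff_right blinfun.diff_left blinfun.add_left
        blinfun.scaleR_left)
  moreover have "(xn t - err t) - s = u - err t" by (simp add: u_def z_def)
  ultimately have "0 \<le> (b - H t u) \<bullet> (u - err t)" by simp
  from regularized_inequality_bound[OF H_coercive less_imp_le[OF mu_pos] M this bA eA h]
  have "\<mu> t * norm u \<le> (1 + h + M) * A" .
  moreover have "\<mu> t * norm z \<le> A" using mz nn unfolding A_eq by linarith
  moreover have "\<mu> t * norm (step t) \<le> \<mu> t * norm u + \<mu> t * norm z"
    using mult_left_mono[OF norm_triangle_ineq[of u z], of "\<mu> t"] mu_pos[of t]
    by (simp add: u_def algebra_simps)
  ultimately show ?thesis unfolding A_def[symmetric] by (simp add: algebra_simps)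
qed

text \<open>At \<open>xn t\<close>, the proximal arguments for the model and for \<open>f\<close>
  differ by the linearization error, the Hessian error and the regularization term. The quotient
  \<open>C / c\<close> measures the Hessian error in units of \<open>\<mu> t\<close>.\<close>

lemma newton_residual_bound:
  assumes small: "(2 + L) * (d t + norm (step t)) \<le> \<epsilon>"
    and C: "0 \<le> C" "norm (J t - hessf (x t)) \<le> C * r (x t) powr \<rho>"
  shows "r (xn t) \<le> (2 + L) * local_err t + \<zeta> * norm (step t) powr (1 + p)
      + (C / c + 1) * (\<mu> t * norm (step t))"
proof -
  let ?p = "step t"
  have "r (xn t) = norm (err t + (prox \<Psi> (xn t - gradf (x t) - H t ?p) - prox \<Psi> (xn t - gradf (xn t))))"
    by (simp add: residual_def err_def)
  also have "\<dots> \<le> norm (err t) + norm ((xn t - gradf (x t) - H t ?p) - (xn t - gradf (xn t)))"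
    using norm_triangle_ineq prox_nonexpansive[OF Psi] by (meson add_left_mono order_trans)
  also have "(xn t - gradf (x t) - H t ?p) - (xn t - gradf (xn t))
      = (gradf (x t + ?p) - gradf (x t) - hessf (x t) ?p) - (J t - hessf (x t)) ?p - \<mu> t *\<^sub>R ?p"
    by (simp add: blinfun.diff_left blinfun.add_left blinfun.scaleR_left)
  also have "norm \<dots> \<le> \<zeta> * norm ?p powr (1 + p) + (C / c) * (\<mu> t * norm ?p) + \<mu> t * norm ?p"
  proof -
    let ?g = "gradf (x t + ?p) - gradf (x t) - hessf (x t) ?p"
    have "norm ((J t - hessf (x t)) ?p) \<le> norm (J t - hessf (x t)) * norm ?p" by (rule norm_blinfun)
    also have "\<dots> \<le> (C * r (x t) powr \<rho>) * norm ?p" using C by (intro mult_right_mono) auto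
    finally have "norm ((J t - hessf (x t)) ?p) \<le> (C / c) * (\<mu> t * norm ?p)" using c_pos by simp
    moreover have "norm ?g \<le> \<zeta> * norm ?p powr (1 + p)" by (rule hoelder_linearization[OF small])
    moreover have "norm (\<mu> t *\<^sub>R ?p) = \<mu> t * norm ?p" using mu_pos[of t] by simp
    ultimately show ?thesis
      using norm_triangle_ineq4[of "?g - (J t - hessf (x t)) ?p" "\<mu> t *\<^sub>R ?p"]
        norm_triangle_ineq4[of ?g "(J t - hessf (x t)) ?p"] by linarith
  qed
  finally have "r (xn t) \<le> norm (err t) + (\<zeta> * norm ?p powr (1 + p) + (C / c) * (\<mu> t * norm ?p) + \<mu> t * norm ?p)"
    by simp
  moreover have "norm (err t) \<le> (2 + L) * local_err t"
  proof -
    have "\<nu> * r (x t) powr (1 + \<rho>) \<le> 1 * r (x t) powr (1 + \<rho>)" using nu by (intro mult_right_mono) auto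
    moreover have "(2 + L) * (r (x t) powr \<rho> * d t) \<le> (2 + L) * local_err t"
      using L_pos by (intro mult_left_mono) (auto simp: local_err_def)
    ultimately show ?thesis using err_norm(2)[of t] residual_powr_le[of t] by linarith
  qed
  ultimately show ?thesis by (simp add: algebra_simps)
qed

text \<open>The exponent \<open>(1 + s) / q\<close>, before the error bound multiplies it by
  \<open>q\<close>. Its entries stem from the regularization terms, from the linearization at a
  nearly closest solution and from the linearization along the step.\<close>

definition rate :: real where
  "rate = min (1 + \<rho>) (min (1 + p) ((1 + p - \<rho> / q) * (1 + p)))"

lemma newton_residual_rate:
  assumes m: "0 < 1 + p - \<rho> / q"
  obtains K where "K > 0" "eventually (\<lambda>t. r (xn t) \<le> K * d t powr rate) sequentially"
proof -
  \<comment> \<open>The order of the step length: eventually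
    \<open>norm (step t) \<le> K2 * d t powr m\<close>.\<close>
  define m where "m = min 1 (1 + p - \<rho> / q)"
  have m_pos: "0 < m" using m by (simp add: m_def)
  have m_rate: "rate \<le> m * (1 + p)" using p m by (auto simp: m_def rate_def min_def)
  obtain C \<theta> where C: "C > 0" "\<theta> \<ge> \<rho>"
    "eventually (\<lambda>t. norm (J t - hessf (x t)) \<le> C * r (x t) powr \<theta>) sequentially"
    by (rule hessian_error)
  define h where "h = L + C + c"
  define K1 where "K1 = (2 + h + c) * (2 + L + 2 * C + 2 * c + 4 * \<zeta>)"
  define K2 where "K2 = K1 * (1 + \<kappa> powr (\<rho> / q)) / c"
  define K3 where "K3 = ((2 + L) + (C / c + 1) * K1) * ((2 + L) powr \<rho> + 1) + \<zeta> * K2 powr (1 + p)"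
  have K1: "0 < K1" using C L_pos c_pos zeta by (simp add: K1_def h_def add_pos_nonneg)
  have K2: "0 < K2" using K1 c_pos by (simp add: K2_def add_pos_nonneg)
  have K3: "0 < K3"
  proof -
    have "0 < (2 + L) + (C / c + 1) * K1" using K1 C c_pos L_pos by (intro add_pos_pos mult_pos_pos) auto
    then have "0 < ((2 + L) + (C / c + 1) * K1) * ((2 + L) powr \<rho> + 1)"
      by (rule mult_pos_pos) (simp add: add_nonneg_pos)
    then show ?thesis unfolding K3_def using zeta by (intro add_pos_nonneg) auto
  qed
  \<comment> \<open>With both \<open>d t\<close> and the step length below this threshold, the
    radius \<open>3 * d t\<close> and the sum \<open>d t + norm (step t)\<close> are
    admissible.\<close>
  have e: "0 < \<epsilon> / (3 * (2 + L))" using eps_kappa_q L_pos by simp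
  have "eventually (\<lambda>t. r (x t) < 1) sequentially" "eventually (\<lambda>t. r (x t) < \<epsilon>) sequentially"
    "eventually (\<lambda>t. d t < 1) sequentially" "eventually (\<lambda>t. d t < \<epsilon> / (3 * (2 + L))) sequentially"
    "eventually (\<lambda>t. K2 * d t powr m < \<epsilon> / (3 * (2 + L))) sequentially"
    using order_tendstoD(2)[OF residual_tendsto_0] order_tendstoD(2)[OF dist_tendsto_0]
      eps_kappa_q e eventually_dist_powr_less[OF m_pos e] by auto
  with C(3) have "eventually (\<lambda>t. r (xn t) \<le> K3 * d t powr rate) sequentially"
  proof eventually_elim
    case (elim t)
    note D = dist_pos[of t] and R = run_residual_pos[of t]
    have "r (x t) powr \<theta> \<le> r (x t) powr \<rho>" using elim C R by (intro powr_mono') auto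
    then have "C * r (x t) powr \<theta> \<le> C * r (x t) powr \<rho>" using C by (intro mult_left_mono) auto
    then have JC: "norm (J t - hessf (x t)) \<le> C * r (x t) powr \<rho>" using elim by linarith
    have "r (x t) powr \<rho> \<le> 1 powr \<rho>" using elim R rho by (intro powr_mono2) auto
    then have r1: "r (x t) powr \<rho> \<le> 1" by simp
    have mu: "\<mu> t \<le> c" using mult_left_mono[OF r1, of c] c_pos by simp
    have "norm (J t - hessf (x t)) \<le> C" using JC mult_left_mono[OF r1 less_imp_le[OF C(1)]] by linarith
    then have h: "norm (H t) \<le> h" using H_norm_le[of t] mu unfolding h_def by linarith
    have de: "3 * ((2 + L) * d t) < \<epsilon>" using elim L_pos by (simp add: field_simps)
    have mp: "\<mu> t * norm (step t) \<le> K1 * local_err t"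
      using local_step_bound[OF _ less_imp_le[OF C(1)] JC h mu] de
      by (simp add: K1_def mult.assoc algebra_simps)
    have "local_err t \<le> r (x t) powr \<rho> * ((1 + \<kappa> powr (\<rho> / q)) * d t powr m)"
      unfolding local_err_def m_def
      using D R elim error_bound eps_kappa_q rho by (intro powr_balance) auto
    then have "K1 * local_err t \<le> K1 * (r (x t) powr \<rho> * ((1 + \<kappa> powr (\<rho> / q)) * d t powr m))"
      using K1 by (intro mult_left_mono) auto
    also have "\<dots> = \<mu> t * (K2 * d t powr m)" using c_pos by (simp add: K2_def)
    finally have "\<mu> t * norm (step t) \<le> \<mu> t * (K2 * d t powr m)" using mp by linarith
    \<comment> \<open>The balanced form of \<open>local_err t\<close> has put the factor
      \<open>\<mu> t\<close> on both sides, so the vanishing regularization cancels.\<close>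
    then have pm: "norm (step t) \<le> K2 * d t powr m"
      using mu_pos[of t] by (simp only: mult_le_cancel_left_pos)
    then have "norm (step t) < \<epsilon> / (3 * (2 + L))" using elim by linarith
    then have "3 * ((2 + L) * norm (step t)) < \<epsilon>" using L_pos by (simp add: field_simps)
    then have "(2 + L) * (d t + norm (step t)) \<le> \<epsilon>" using de eps_kappa_q by (simp add: distrib_left)
    from newton_residual_bound[OF this less_imp_le[OF C(1)] JC]
    have 1: "r (xn t) \<le> (2 + L) * local_err t + \<zeta> * norm (step t) powr (1 + p)
      + (C / c + 1) * (\<mu> t * norm (step t))" .
    have "(C / c + 1) * (\<mu> t * norm (step t)) \<le> (C / c + 1) * (K1 * local_err t)"
      using mp C c_pos by (intro mult_left_mono) auto
    then have 2: "r (xn t) \<le> ((2 + L) + (C / c + 1) * K1) * local_err t + \<zeta> * norm (step t) powr (1 + p)"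
      using 1 by (simp add: algebra_simps)
    have "norm (step t) powr (1 + p) \<le> (K2 * d t powr m) powr (1 + p)"
      using pm p by (intro powr_mono2) auto
    also have "\<dots> = K2 powr (1 + p) * d t powr (m * (1 + p))"
      using K2 by (simp add: powr_mult powr_powr)
    also have "\<dots> \<le> K2 powr (1 + p) * d t powr rate"
      using D elim m_rate by (intro mult_left_mono powr_mono') auto
    finally have 3: "\<zeta> * norm (step t) powr (1 + p) \<le> \<zeta> * (K2 powr (1 + p) * d t powr rate)"
      using zeta by (intro mult_left_mono) auto
    \<comment> \<open>No division by \<open>\<mu> t\<close> follows here, so the residual is bounded
      by the distance directly, without loss in the exponent.\<close>
    have "r (x t) powr \<rho> \<le> ((2 + L) * d t) powr \<rho>"
      using R rho residual_le_infdist by (intro powr_mono2) auto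
    then have "r (x t) powr \<rho> * d t \<le> ((2 + L) * d t) powr \<rho> * d t" using D by (intro mult_right_mono) auto
    also have "\<dots> = (2 + L) powr \<rho> * d t powr (1 + \<rho>)"
      using L_pos D by (simp add: powr_mult powr_add)
    also have "\<dots> \<le> (2 + L) powr \<rho> * d t powr rate"
      using D elim by (intro mult_left_mono powr_mono') (auto simp: rate_def)
    finally have "r (x t) powr \<rho> * d t \<le> (2 + L) powr \<rho> * d t powr rate" .
    moreover have "d t powr (1 + p) \<le> d t powr rate"
      using D elim by (intro powr_mono') (auto simp: rate_def)
    ultimately have 4: "local_err t \<le> ((2 + L) powr \<rho> + 1) * d t powr rate"
      by (simp add: local_err_def algebra_simps)
    have "((2 + L) + (C / c + 1) * K1) * local_err t
        \<le> ((2 + L) + (C / c + 1) * K1) * (((2 + L) powr \<rho> + 1) * d t powr rate)"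
      using 4 K1 C c_pos L_pos by (intro mult_left_mono) auto
    with 2 3 have "r (xn t) \<le> ((2 + L) + (C / c + 1) * K1) * (((2 + L) powr \<rho> + 1) * d t powr rate)
        + \<zeta> * (K2 powr (1 + p) * d t powr rate)" by linarith
    then show ?case by (simp only: K3_def distrib_right mult.assoc)
  qed
  then show ?thesis using that K3 by blast
qed

section \<open>Acceptance of unit steps and the superlinear rates\<close>

lemma unit_step_accepted:
  assumes "step_accepted f gradf \<Psi> L \<gamma> \<delta> (x t) (step t) 1"
  shows "\<alpha> t = 1"
proof -
  obtain k where "\<alpha> t = \<beta> ^ k" "\<forall>j<k. \<not> step_accepted f gradf \<Psi> L \<gamma> \<delta> (x t) (step t) (\<beta> ^ j)"
    by (rule run_line_search)
  then show ?thesis using assms by (cases k) auto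
qed

lemma local_convergence:
  assumes m_pos: "0 < 1 + p - \<rho> / q" and rate: "1 < q * rate"
    and delta_small: "(\<lambda>t. norm (step t) powr (2 + \<delta>)) \<in> o(\<lambda>t. d t powr ((q + 1) / q))"
  obtains t\<^sub>0 C where "C > 0" "\<forall>t\<ge>t\<^sub>0. \<alpha> t = 1"
    "\<forall>t\<ge>t\<^sub>0. d (Suc t) \<le> C * d t powr (q * rate)"
    "\<forall>t\<ge>t\<^sub>0. r (x (Suc t)) \<le> C * r (x t) powr (q * rate)"
    "\<forall>t\<ge>t\<^sub>0. F (x (Suc t)) - (INF z. F z)
        \<le> ereal (C * real_of_ereal (F (x t) - (INF z. F z)) powr (q * rate))"
proof -
  note q_pos = eps_kappa_q(3)
  have "rate > 0" using rate q_pos by (smt (verit) zero_less_mult_pos)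
  obtain m where m: "(INF z. F z) = ereal m" by (rule solution_finite)
  obtain K where K: "K > 0" "eventually (\<lambda>t. r (xn t) \<le> K * d t powr rate) sequentially"
    by (rule newton_residual_rate[OF m_pos])
  define C1 where "C1 = 2 * (1 + L) * K"
  define C2 where "C2 = \<kappa> * C1 powr q"
  define c0 where "c0 = min (1/4) ((1 / (2 * \<kappa>)) powr (2 / q))"
  \<comment> \<open>One constant for all three estimates: the summands serve the residual, the
    distance and the gap, in this order.\<close>
  define C where "C = C1 * \<kappa> powr rate + C2 + C1 * C2 * (1 / c0) powr (q * rate)"
  \<comment> \<open>The surplus of the gap exponent \<open>rate + q * rate\<close> over the growth
    exponent \<open>(q + 1) / q\<close>; it is positive because \<open>rate\<close> exceeds
    \<open>1 / q\<close>.\<close>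
  define \<sigma> where "\<sigma> = (rate - 1 / q) * (q + 1)"
  have pos: "C1 > 0" "C2 > 0" "c0 > 0"
    using K L_pos eps_kappa_q by (auto simp: C1_def C2_def c0_def)
  have C_ge: "C1 * \<kappa> powr rate \<le> C" "C2 \<le> C" "C1 * C2 * (1 / c0) powr (q * rate) \<le> C"
    using pos eps_kappa_q by (auto simp: C_def)
  have "C > 0" using pos C_ge by linarith
  have "1 / q < rate" using rate q_pos by (simp add: field_simps)
  then have \<sigma>: "\<sigma> > 0" using q_pos by (simp add: \<sigma>_def)
  have exps: "rate + q * rate = (q + 1) / q + \<sigma>" "((q + 1) / q) * (q * rate) = rate + q * rate"
    using q_pos by (auto simp: \<sigma>_def field_simps)
  \<comment> \<open>Half of the growth pays for the gap at the trial point, the other half for the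
    decrease demanded by the line search.\<close>
  have c2: "0 < c0 / 2" using pos by simp
  have small: "eventually (\<lambda>t. norm (norm (step t) powr (2 + \<delta>)) \<le> c0 / 2 * norm (d t powr ((q + 1) / q))) sequentially"
    by (rule landau_o.smallD[OF delta_small c2])
  have e: "0 < \<epsilon> / (2 * (2 + L))" using eps_kappa_q L_pos by simp
  have "eventually (\<lambda>t. r (x t) < \<epsilon>) sequentially" "eventually (\<lambda>t. d t < \<epsilon> / (2 * (2 + L))) sequentially"
    "eventually (\<lambda>t. C1 * d t powr rate < \<epsilon>) sequentially"
    "eventually (\<lambda>t. (C1 * C2) * d t powr \<sigma> < c0 / 2) sequentially"
    "eventually (\<lambda>t. 1 \<le> t) sequentially"
    using order_tendstoD(2)[OF residual_tendsto_0] order_tendstoD(2)[OF dist_tendsto_0] e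
      eps_kappa_q eventually_dist_powr_less[OF \<open>rate > 0\<close>] eventually_dist_powr_less[OF \<sigma> c2]
      eventually_ge_at_top by auto
  with K(2) small have "eventually (\<lambda>t. \<alpha> t = 1 \<and> d (Suc t) \<le> C * d t powr (q * rate) \<and>
      r (x (Suc t)) \<le> C * r (x t) powr (q * rate) \<and> F (x (Suc t)) - (INF z. F z)
        \<le> ereal (C * real_of_ereal (F (x t) - (INF z. F z)) powr (q * rate))) sequentially"
  proof eventually_elim
    case (elim t)
    note D = dist_pos[of t]
    \<comment> \<open>Index 0 is excluded since the objective may be infinite there.\<close>
    obtain t' where t': "t = Suc t'" using elim(7) by (cases t) auto
    have Ft: "F (x t) = ereal (Fval t)" unfolding t' by (rule Fval_Suc)
    define y where "y = pg (xn t)"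
    obtain a where a: "F y = ereal a" unfolding y_def by (rule pg_finite)
    have "r y \<le> 2 * (1 + L) * r (xn t)" unfolding y_def by (rule pg_residual_le)
    also have rxn: "\<dots> \<le> C1 * d t powr rate"
      using mult_left_mono[OF elim(1), of "2 * (1 + L)"] L_pos by (simp add: C1_def mult.assoc)
    finally have ry: "r y \<le> C1 * d t powr rate" .
    then have "infdist y S \<le> \<kappa> * r y powr q" using elim by (intro error_bound) simp
    also have "\<dots> \<le> \<kappa> * (C1 * d t powr rate) powr q"
      using ry r_nonneg eps_kappa_q by (intro mult_left_mono powr_mono2) auto
    also have "\<dots> = C2 * d t powr (q * rate)"
      using pos by (simp add: C2_def powr_mult powr_powr mult.commute)
    finally have dy: "infdist y S \<le> C2 * d t powr (q * rate)" .
    have "a - m \<le> (2 * (1 + L) * r (xn t)) * infdist y S"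
      using pg_gap[of "xn t" a m] a m by (simp add: y_def)
    also have "\<dots> \<le> (C1 * d t powr rate) * (C2 * d t powr (q * rate))"
      by (rule mult_mono[OF rxn dy]) (use pos in \<open>simp_all add: infdist_nonneg\<close>)
    also have "\<dots> = C1 * C2 * d t powr (rate + q * rate)" by (simp add: powr_add)
    finally have gap: "a - m \<le> C1 * C2 * d t powr (rate + q * rate)" .
    have "2 * (2 + L) * d t \<le> \<epsilon>" using elim(4) L_pos by (simp add: field_simps)
    from growth[OF eps_kappa_q(2,3) error_bound Ft m D this]
    have gr: "c0 * d t powr ((q + 1) / q) \<le> Fval t - m" by (simp add: c0_def)
    have "(C1 * C2 * d t powr \<sigma>) * d t powr ((q + 1) / q) \<le> (c0 / 2) * d t powr ((q + 1) / q)"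
      using elim(6) by (intro mult_right_mono) auto
    then have "a - m \<le> (c0 / 2) * d t powr ((q + 1) / q)"
      using gap by (simp add: exps(1) powr_add mult_ac)
    moreover have "norm (step t) powr (2 + \<delta>) \<le> (c0 / 2) * d t powr ((q + 1) / q)"
      using elim(2) by simp
    moreover have "\<gamma> * norm (step t) powr (2 + \<delta>) \<le> 1 * norm (step t) powr (2 + \<delta>)"
      using gamma by (intro mult_right_mono) auto
    ultimately have "a \<le> Fval t - \<gamma> * norm (step t) powr (2 + \<delta>)" using gr by linarith
    then have "step_accepted f gradf \<Psi> L \<gamma> \<delta> (x t) (step t) 1"
      using a Ft by (simp add: step_accepted_def trial_point_def y_def)
    then have alpha: "\<alpha> t = 1" by (rule unit_step_accepted)
    then have next_x: "x (Suc t) = y" by (simp add: run_next y_def)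
    have "C2 * d t powr (q * rate) \<le> C * d t powr (q * rate)"
      using C_ge by (intro mult_right_mono) auto
    then have dist: "d (Suc t) \<le> C * d t powr (q * rate)" using dy next_x by simp
    have "d t powr rate \<le> (\<kappa> * r (x t) powr q) powr rate"
      using D elim error_bound \<open>rate > 0\<close> by (intro powr_mono2) auto
    also have "\<dots> = \<kappa> powr rate * r (x t) powr (q * rate)"
      using eps_kappa_q by (simp add: powr_mult powr_powr)
    finally have "C1 * d t powr rate \<le> C1 * (\<kappa> powr rate * r (x t) powr (q * rate))"
      using pos by (intro mult_left_mono) auto
    also have "\<dots> = (C1 * \<kappa> powr rate) * r (x t) powr (q * rate)" by simp
    also have "\<dots> \<le> C * r (x t) powr (q * rate)" using C_ge by (intro mult_right_mono) auto
    finally have res: "r (x (Suc t)) \<le> C * r (x t) powr (q * rate)" using ry next_x by simp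
    \<comment> \<open>Growth read backwards bounds the distance by the gap; raised to the power
      \<open>q * rate\<close> it reproduces exactly the power of the distance that bounds
      \<open>a - m\<close>.\<close>
    have "d t powr ((q + 1) / q) \<le> (1 / c0) * (Fval t - m)" using gr pos by (simp add: field_simps)
    then have "(d t powr ((q + 1) / q)) powr (q * rate) \<le> ((1 / c0) * (Fval t - m)) powr (q * rate)"
      using rate by (intro powr_mono2) auto
    also have "((1 / c0) * (Fval t - m)) powr (q * rate) = (1 / c0) powr (q * rate) * (Fval t - m) powr (q * rate)"
      by (rule powr_mult)
    finally have "d t powr (rate + q * rate) \<le> (1 / c0) powr (q * rate) * (Fval t - m) powr (q * rate)"
      using exps(2) by (simp add: powr_powr)
    then have "C1 * C2 * d t powr (rate + q * rate)
        \<le> C1 * C2 * ((1 / c0) powr (q * rate) * (Fval t - m) powr (q * rate))"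
      using pos by (intro mult_left_mono) auto
    also have "\<dots> = (C1 * C2 * (1 / c0) powr (q * rate)) * (Fval t - m) powr (q * rate)" by simp
    also have "\<dots> \<le> C * (Fval t - m) powr (q * rate)" using C_ge by (intro mult_right_mono) auto
    finally have "a - m \<le> C * (Fval t - m) powr (q * rate)" using gap by linarith
    then have "F (x (Suc t)) - (INF z. F z) \<le> ereal (C * real_of_ereal (F (x t) - (INF z. F z)) powr (q * rate))"
      unfolding next_x m Ft a by simp
    with alpha dist res show ?case by blast
  qed
  then obtain t0 where "\<forall>t\<ge>t0. \<alpha> t = 1 \<and> d (Suc t) \<le> C * d t powr (q * rate) \<and>
      r (x (Suc t)) \<le> C * r (x t) powr (q * rate) \<and> F (x (Suc t)) - (INF z. F z)
        \<le> ereal (C * real_of_ereal (F (x t) - (INF z. F z)) powr (q * rate))"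
    unfolding eventually_sequentially by blast
  then show ?thesis using that[of C t0] \<open>C > 0\<close> by blast
qed

end

section \<open>From the internal exponent \<open>rate\<close> to the rates in terms of
  \<open>s\<close>\<close>

theorem theorem3p3:
  fixes f :: "'a::{real_inner, complete_space} \<Rightarrow> real"
    and gradf :: "'a \<Rightarrow> 'a"
    and hessf :: "'a \<Rightarrow> 'a \<Rightarrow>\<^sub>L 'a"
    and \<Psi> :: "'a \<Rightarrow> ereal"
    and L \<epsilon> \<kappa> q p \<beta> \<gamma> \<nu> \<rho> c \<delta> s :: real
    and x xn :: "nat \<Rightarrow> 'a"
    and J :: "nat \<Rightarrow> 'a \<Rightarrow>\<^sub>L 'a"
    and \<alpha> :: "nat \<Rightarrow> real"
  defines "F \<equiv> objective f \<Psi>"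
    and "r \<equiv> residual gradf \<Psi>"
    and "S \<equiv> solutions gradf \<Psi>"
    and "Fstar \<equiv> (INF z. objective f \<Psi> z)"
    and "V \<equiv> {z. residual gradf \<Psi> z \<le> \<epsilon>}"
    and "d \<equiv> (\<lambda>t. infdist (x t) (solutions gradf \<Psi>))"
    and "s \<equiv> min ((1 + \<rho>) * q) (min ((1 + p) * q) ((q + p * q - \<rho>) * (1 + p))) - 1"
  assumes f_convex: "convex_on UNIV f"
    and f_grad: "\<And>z. GDERIV f z :> gradf z"
    and f_hess: "\<And>z. (gradf has_derivative blinfun_apply (hessf z)) (at z)"
    and hess_cont: "continuous_on UNIV hessf"
    and L_pos: "L > 0"
    and grad_lipschitz: "L-lipschitz_on UNIV gradf"
    and Psi: "convex_fun \<Psi>" "proper_fun \<Psi>" "closed_fun \<Psi>"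
    and S_nonempty: "S \<noteq> {}"
    and eps_kappa_q: "\<epsilon> > 0" "\<kappa> > 0" "q > 0"
    and error_bound: "\<And>z. z \<in> V \<Longrightarrow> infdist z S \<le> \<kappa> * r z powr q"
    and p: "0 < p" "p \<le> 1"
    and hess_hoelder:
      "\<exists>\<zeta>\<ge>0. \<forall>y\<in>V. \<forall>z\<in>V. norm (hessf y - hessf z) \<le> \<zeta> * norm (y - z) powr p"
    and beta: "0 < \<beta>" "\<beta> < 1"
    and gamma: "0 < \<gamma>" "\<gamma> < 1"
    and nu: "0 \<le> \<nu>" "\<nu> < 1"
    and rho: "0 < \<rho>" "\<rho> \<le> 1"
    and c_pos: "c > 0"
    and delta_pos: "\<delta> > 0"
    and exponents: "(1 + \<rho>) * q > 1" "(1 + p) * q > 1" "(q + p * q - \<rho>) * (1 + p) > 1"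
    and run: "newton_run f gradf hessf \<Psi> L \<beta> \<gamma> \<nu> \<rho> c \<delta> x xn J \<alpha>"
    and delta_small:
      "(\<lambda>t. norm (xn t - x t) powr (2 + \<delta>)) \<in> o(\<lambda>t. d t powr ((q + 1) / q))"
  shows "s > 0 \<and>
    (\<exists>t\<^sub>0. (\<forall>t\<ge>t\<^sub>0. \<alpha> t = 1) \<and>
      (\<exists>C>0. \<forall>t\<ge>t\<^sub>0. d (Suc t) \<le> C * d t powr (1 + s)) \<and>
      (\<exists>C>0. \<forall>t\<ge>t\<^sub>0. r (x (Suc t)) \<le> C * r (x t) powr (1 + s)) \<and>
      (\<exists>C>0. \<forall>t\<ge>t\<^sub>0. F (x (Suc t)) - Fstar
                      \<le> ereal (C * real_of_ereal (F (x t) - Fstar) powr (1 + s))))"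
proof -
  obtain \<zeta> where \<zeta>: "\<zeta> \<ge> 0"
    "\<forall>y\<in>V. \<forall>z\<in>V. norm (hessf y - hessf z) \<le> \<zeta> * norm (y - z) powr p"
    using hess_hoelder by blast
  interpret newton_problem f gradf hessf \<Psi> L \<epsilon> \<kappa> q p \<zeta> \<beta> \<gamma> \<nu> \<rho> c \<delta> x xn J \<alpha>
  proof
    show "infdist z (solutions gradf \<Psi>) \<le> \<kappa> * residual gradf \<Psi> z powr q"
      if "residual gradf \<Psi> z \<le> \<epsilon>" for z
      using error_bound[of z] that by (simp add: V_def S_def r_def)
    show "norm (hessf y - hessf z) \<le> \<zeta> * norm (y - z) powr p"
      if "residual gradf \<Psi> y \<le> \<epsilon>" "residual gradf \<Psi> z \<le> \<epsilon>" for y z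
      using \<zeta>(2) that by (simp add: V_def)
  qed (fact f_convex f_grad f_hess L_pos grad_lipschitz Psi S_nonempty[unfolded S_def]
      eps_kappa_q p \<zeta>(1) beta gamma nu rho c_pos delta_pos run)+
  have mult_min: "q * min a b = min (q * a) (q * b)" for a b
    using eps_kappa_q(3) by (simp add: min_mult_distrib_left)
  have e: "q * ((1 + p - \<rho> / q) * (1 + p)) = (q + p * q - \<rho>) * (1 + p)"
    using eps_kappa_q(3) by (simp add: field_simps)
  have s: "q * rate = 1 + s"
    unfolding rate_def s_def mult_min e by (simp add: mult.commute)
  have s_pos: "s > 0" using exponents by (simp add: s_def)
  \<comment> \<open>The third exponent condition makes the order of the step length positive, as the
    local analysis requires.\<close>
  have "0 < (q + p * q - \<rho>) * (1 + p)" using exponents(3) by linarith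
  then have "0 < q + p * q - \<rho>" using p by (simp add: zero_less_mult_iff)
  then have m: "0 < 1 + p - \<rho> / q" using eps_kappa_q(3) by (simp add: field_simps)
  have "1 < q * rate" using s s_pos by simp
  obtain t0 C where "C > 0" "\<forall>t\<ge>t0. \<alpha> t = 1"
    "\<forall>t\<ge>t0. infdist (x (Suc t)) (solutions gradf \<Psi>) \<le> C * infdist (x t) (solutions gradf \<Psi>) powr (q * rate)"
    "\<forall>t\<ge>t0. residual gradf \<Psi> (x (Suc t)) \<le> C * residual gradf \<Psi> (x t) powr (q * rate)"
    "\<forall>t\<ge>t0. objective f \<Psi> (x (Suc t)) - (INF z. objective f \<Psi> z)
        \<le> ereal (C * real_of_ereal (objective f \<Psi> (x t) - (INF z. objective f \<Psi> z)) powr (q * rate))"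
    by (rule local_convergence[OF m \<open>1 < q * rate\<close> delta_small[unfolded d_def]])
  then show ?thesis
    unfolding s d_def r_def F_def Fstar_def using s_pos by blast
qed

end
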